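(* For every $\gamma>0$ there exist $\eta>0$ and $n_0\in\mathbb{N}$ such that the following holds for every $n>n_0$. Let $T$ be an $n$-vertex tree with maximum degree $\Delta(T)\le\frac{\eta n}{\log n}$, and let $N=\lceil(2+2\gamma)n\rceil-1$. Then $N$ copies of $T$ can be packed cyclically into the complete graph $K_N$.
   Context: $\log$ denotes the natural logarithm. Regard the vertices of $K_N$ as the integers $0,1,\ldots,N-1$. For a subgraph $G$ of $K_N$, its cyclic shift is the subgraph $S(G)$ with vertex set $\{x+1: x\in V(G)\}$ and edge set $\{\{x+1,y+1\}: \{x,y\}\in E(G)\}$, where addition is modulo $N$. We say that $N$ copies of $T$ can be packed cyclically into $K_N$ if there is a subgraph $T'$ of $K_N$ isomorphic to $T$ such that the $N$ cyclic shifts $T',S(T'),S^2(T'),\ldots,S^{N-1}(T')$ are pairwise edge-disjoint. *)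

theory Defs
  imports Complex_Main "HOL-Library.Disjoint_Sets"
begin

text \<open>Finite simple undirected graphs, with edges as two-element vertex sets.\<close>

record 'a ugraph =
  verts :: "'a set"
  edges :: "'a set set"

definition simple_graph :: "'a ugraph \<Rightarrow> bool" where
  "simple_graph G \<longleftrightarrow> finite (verts G) \<and> (\<forall>e \<in> edges G. e \<subseteq> verts G \<and> card e = 2)"

definition subgraph :: "'a ugraph \<Rightarrow> 'a ugraph \<Rightarrow> bool" where
  "subgraph H G \<longleftrightarrow> simple_graph H \<and> simple_graph G \<and> verts H \<subseteq> verts G \<and> edges H \<subseteq> edges G"

definition graph_isomorphic :: "'a ugraph \<Rightarrow> 'b ugraph \<Rightarrow> bool" where
  "graph_isomorphic G H \<longleftrightarrow>
     (\<exists>f. bij_betw f (verts G) (verts H) \<and>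
       (\<forall>u \<in> verts G. \<forall>v \<in> verts G. {u, v} \<in> edges G \<longleftrightarrow> {f u, f v} \<in> edges H))"

definition vertex_degree :: "'a ugraph \<Rightarrow> 'a \<Rightarrow> nat" where
  "vertex_degree G v = card {e \<in> edges G. v \<in> e}"

definition max_degree :: "'a ugraph \<Rightarrow> nat" where
  "max_degree G = Max (vertex_degree G ` verts G)"

definition walk :: "'a ugraph \<Rightarrow> 'a list \<Rightarrow> bool" where
  "walk G p \<longleftrightarrow> p \<noteq> [] \<and> set p \<subseteq> verts G \<and> successively (\<lambda>u v. {u, v} \<in> edges G) p"

definition connected_graph :: "'a ugraph \<Rightarrow> bool" where
  "connected_graph G \<longleftrightarrow> verts G \<noteq> {} \<and>
     (\<forall>u \<in> verts G. \<forall>v \<in> verts G. \<exists>p. walk G p \<and> hd p = u \<and> last p = v)"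

text \<open>A cycle is given by its distinct vertices in order, without repeating the first at the end.\<close>

definition graph_cycle :: "'a ugraph \<Rightarrow> 'a list \<Rightarrow> bool" where
  "graph_cycle G p \<longleftrightarrow> walk G p \<and> distinct p \<and> length p \<ge> 3 \<and> {last p, hd p} \<in> edges G"

definition tree :: "'a ugraph \<Rightarrow> bool" where
  "tree G \<longleftrightarrow> simple_graph G \<and> connected_graph G \<and> (\<nexists>p. graph_cycle G p)"

definition complete_graph :: "nat \<Rightarrow> nat ugraph" where
  "complete_graph N = \<lparr>verts = {0..<N}, edges = {e. e \<subseteq> {0..<N} \<and> card e = 2}\<rparr>"

definition cyclic_shift :: "nat \<Rightarrow> nat ugraph \<Rightarrow> nat ugraph" where
  "cyclic_shift N G =
     \<lparr>verts = {(x + 1) mod N | x. x \<in> verts G},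
      edges = {{(x + 1) mod N, (y + 1) mod N} | x y. {x, y} \<in> edges G}\<rparr>"

text \<open>Disjointness is required of the family indexed by \<open>i < N\<close>, so shifts with different
  indices must be edge-disjoint even where they coincide as graphs.\<close>

definition packs_cyclically :: "'a ugraph \<Rightarrow> nat \<Rightarrow> bool" where
  "packs_cyclically T N \<longleftrightarrow>
     (\<exists>T'. subgraph T' (complete_graph N) \<and> graph_isomorphic T T' \<and>
       disjoint_family_on (\<lambda>i. edges ((cyclic_shift N ^^ i) T')) {0..<N})"

end

theory Submission
  imports Defs
begin

text \<open>
  A tree packs cyclically into the complete graph on the residues modulo N as soon as its vertices can be
  labelled by distinct residues such that the differences along distinct edges differ, also up to sign, and
  no difference equals its own negative (\<open>packing_from_labels\<close>). Order the vertices so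
  that each has exactly one earlier neighbour, its parent (\<open>tree_order\<close>), and label
  them one after the other. If U is the set of unused signed differences and L the set of unused labels, a
  vertex whose parent has label p may receive any w in L with w - p in U. About a proportion
  \<gamma> / (1 + \<gamma>) of the differences and more than half of the labels remain unused to the end, so
  there would always be plenty of choices if U and L looked like independent random sets. The proof chooses w
  so that they do.

  Being like random sets is measured by patterns: for a set F of forms one counts the residues x
  such that prescribed translates x + a lie in U and prescribed x + b or b - x lie in L, and compares
  the count with the product of the densities. If w is drawn uniformly from the available labels, the expected loss
  of a pattern in one step is a sum of counts of patterns with one more form, divided by the number of
  available labels, which is itself a pattern count (\<open>sum_loss_approx\<close>,
  \<open>clean_drift\<close>). This holds wherever the parent was placed, up to few exceptional
  labels p. Thus the error for patterns of size j grows at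
  a rate of j times the error for size j + 1. This infinite hierarchy is cut off at size J, where the trivial bound is used,
  and over a short stage, a constant proportion of all steps, accuracy \<open>1 / 2 ^ J\<close> for
  patterns up to size J turns into accuracy \<open>1 / 2 ^ (J div 4)\<close> for patterns up to size
  \<open>J div 4\<close> (\<open>stage\<close>). The number of stages is bounded in terms of \<gamma>, so a
  constant initial J suffices (\<open>full_labelling\<close>).

  The drift computation fails only if p is in special position to the pattern. There are at most
  \<open>(card F)\<^sup>2\<close> such labels p, and each is the label of a parent in at most as many steps as
  the maximum degree, which makes these steps negligible (\<open>degenerate_steps_le\<close>). Since the number of
  patterns is polynomial in N while the deviations have bounded steps, exponential moments control all
  of them simultaneously, and a potential function replaces the random choice (\<open>derandomise\<close>).
\<close>

section \<open>Trees and cyclic packings\<close>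
lemma successively_crossing:
  assumes "successively R p" "p \<noteq> []" "hd p \<in> S" "last p \<notin> S"
  shows "\<exists>a b. a \<in> S \<and> b \<notin> S \<and> b \<in> set p \<and> R a b"
  using assms
proof (induction p rule: induct_list012)
  case (3 x y zs)
  show ?case
  proof (cases "y \<in> S")
    case True
    then show ?thesis using 3 by auto
  next
    case False
    then show ?thesis using 3 by auto
  qed
qed auto

text \<open>Paths instead of walks, so that a path between two neighbours of an outside vertex closes up to
  a cycle at once.\<close>
definition linked :: "'a ugraph \<Rightarrow> 'a set \<Rightarrow> bool" where
  "linked G S \<longleftrightarrow> (\<forall>u\<in>S. \<forall>v\<in>S. \<exists>p. walk G p \<and> distinct p \<and> set p \<subseteq> S \<and> hd p = u \<and> last p = v)"

lemma linked_insert: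
  assumes l: "linked G S" and a: "a \<in> S" "{a, b} \<in> edges G" "b \<notin> S" "b \<in> verts G"
  shows "linked G (insert b S)"
  unfolding linked_def
proof (intro ballI)
  fix u v assume u: "u \<in> insert b S" and v: "v \<in> insert b S"
  have path: "\<exists>p. walk G p \<and> distinct p \<and> set p \<subseteq> S \<and> hd p = u \<and> last p = v" if "u \<in> S" "v \<in> S" for u v
    using l that by (auto simp: linked_def)
  consider "u = b" "v = b" | "u = b" "v \<in> S" | "u \<in> S" "v = b" | "u \<in> S" "v \<in> S" using u v by auto
  then show "\<exists>p. walk G p \<and> distinct p \<and> set p \<subseteq> insert b S \<and> hd p = u \<and> last p = v"
  proof cases
    case 1 then show ?thesis using a by (intro exI[of _ "[b]"]) (auto simp: walk_def)
  next
    case 2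
    obtain p where "walk G p" "distinct p" "set p \<subseteq> S" "hd p = a" "last p = v" using path[OF a(1) 2(2)] by blast
    then show ?thesis using a 2
      by (intro exI[of _ "b # p"]) (auto simp: walk_def successively_Cons insert_commute)
  next
    case 3
    obtain p where "walk G p" "distinct p" "set p \<subseteq> S" "hd p = u" "last p = a" using path[OF 3(1) a(1)] by blast
    then show ?thesis using a 3
      by (intro exI[of _ "p @ [b]"]) (auto simp: walk_def successively_append_iff)
  next
    case 4 then show ?thesis using path[of u v] by blast
  qed
qed

text \<open>Two neighbours of b in S would be joined by a path inside S, which b completes to a cycle.\<close>
lemma tree_unique_attachment:
  assumes T: "tree T" and l: "linked T S" and b: "b \<in> verts T" "b \<notin> S"
    and a: "a \<in> S" "{b, a} \<in> edges T" and a': "a' \<in> S" "{b, a'} \<in> edges T"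
  shows "a = a'"
proof (rule ccontr)
  assume ne: "a \<noteq> a'"
  obtain p where p: "walk T p" "distinct p" "set p \<subseteq> S" "hd p = a" "last p = a'"
    using l a(1) a'(1) unfolding linked_def by blast
  have "length p \<ge> 2" using p(1,4,5) ne
    by (cases p; cases "tl p") (auto simp: walk_def)
  then have "graph_cycle T (b # p)" using p b a a'
    by (auto simp: graph_cycle_def walk_def successively_Cons insert_commute)
  then show False using T by (auto simp: tree_def)
qed

text \<open>Vertices are added one at a time, each adjacent to an earlier one. The vertices listed so far stay
  linked, so the earlier neighbour is unique; it is the parent. Hence the edges of the tree are exactly
  the pairs of a vertex and its parent.\<close>
lemma tree_order:
  assumes T: "tree T" and n: "card (verts T) = n"
  obtains vs par where "distinct vs" "set vs = verts T" "length vs = n"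
    "\<And>i. 1 \<le> i \<Longrightarrow> i < n \<Longrightarrow> par i < i \<and> {vs ! i, vs ! par i} \<in> edges T"
    "\<And>i j. j < i \<Longrightarrow> i < n \<Longrightarrow> {vs ! i, vs ! j} \<in> edges T \<Longrightarrow> j = par i"
proof -
  have fin: "finite (verts T)" and ne: "verts T \<noteq> {}"
    and conn: "\<And>u v. u \<in> verts T \<Longrightarrow> v \<in> verts T \<Longrightarrow> \<exists>p. walk T p \<and> hd p = u \<and> last p = v"
    using T by (auto simp: tree_def simple_graph_def connected_graph_def)
  let ?good = "\<lambda>vs. distinct vs \<and> set vs \<subseteq> verts T \<and> linked T (set vs) \<and>
    (\<forall>i\<in>{1..<length vs}. \<exists>!j. j < i \<and> {vs ! i, vs ! j} \<in> edges T)"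
  have "\<exists>vs. length vs = k \<and> ?good vs" if "1 \<le> k" "k \<le> n" for k
    using that
  proof (induction k rule: dec_induct)
    case base
    obtain v where "v \<in> verts T" using ne by auto
    then show ?case by (intro exI[of _ "[v]"]) (auto simp: linked_def walk_def intro!: exI[of _ "[v]"])
  next
    case (step k)
    then obtain vs where vs: "length vs = k" "?good vs" by auto
    have "card (set vs) < card (verts T)" using vs distinct_card[of vs] step n by simp
    then have "\<not> verts T \<subseteq> set vs" using card_mono[of "set vs" "verts T"] by auto
    then obtain v where v: "v \<in> verts T" "v \<notin> set vs" by auto
    have h: "hd vs \<in> set vs" using vs step by (intro hd_in_set) auto
    obtain p where p: "walk T p" "hd p = hd vs" "last p = v" using conn[of "hd vs" v] vs(2) v h by blast
    obtain a b where ab: "a \<in> set vs" "b \<notin> set vs" "b \<in> set p" "{a, b} \<in> edges T"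
      using successively_crossing[of "\<lambda>u v. {u, v} \<in> edges T" p "set vs"] p h v by (auto simp: walk_def)
    have bT: "b \<in> verts T" using ab p by (auto simp: walk_def)
    have "linked T (insert b (set vs))" using vs ab bT by (intro linked_insert[of T "set vs" a b]) auto
    moreover have "\<exists>!j. j < i \<and> {(vs @ [b]) ! i, (vs @ [b]) ! j} \<in> edges T"
      if i: "i \<in> {1..<length (vs @ [b])}" for i
    proof (cases "i < k")
      case True
      then have "(vs @ [b]) ! i = vs ! i" "\<And>j. j < i \<Longrightarrow> (vs @ [b]) ! j = vs ! j"
        using vs(1) by (auto simp: nth_append)
      moreover have "\<exists>!j. j < i \<and> {vs ! i, vs ! j} \<in> edges T" using vs i True by auto
      ultimately show ?thesis by (metis (no_types, lifting))
    next
      case False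
      then have ik: "i = k" using i vs(1) by auto
      have nb: "(vs @ [b]) ! i = b" "\<And>j. j < i \<Longrightarrow> (vs @ [b]) ! j = vs ! j"
        using vs(1) ik by (auto simp: nth_append)
      obtain j where j: "j < k" "vs ! j = a" using ab(1) vs(1) by (auto simp: in_set_conv_nth)
      show ?thesis
      proof (rule ex1I[of _ j])
        show "j < i \<and> {(vs @ [b]) ! i, (vs @ [b]) ! j} \<in> edges T"
          using nb j ik ab by (simp add: insert_commute)
        fix j' assume j': "j' < i \<and> {(vs @ [b]) ! i, (vs @ [b]) ! j'} \<in> edges T"
        then have "{b, vs ! j'} \<in> edges T" "vs ! j' \<in> set vs" using nb(1) nb(2)[of j'] ik vs(1) by auto
        then have "vs ! j' = a"
          using tree_unique_attachment[OF T _ bT ab(2), of "vs ! j'" a] vs ab(1,4) by (simp add: insert_commute)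
        then show "j' = j" using j j' ik vs nth_eq_iff_index_eq[of vs j' j] by auto
      qed
    qed
    ultimately show ?case using vs ab bT by (intro exI[of _ "vs @ [b]"]) auto
  qed
  moreover have n1: "1 \<le> n" using n fin ne by (metis One_nat_def Suc_leI card_gt_0_iff)
  ultimately obtain vs where vs: "length vs = n" "?good vs" by blast
  have "set vs = verts T" using vs n fin by (metis card_subset_eq distinct_card)
  define par where "par i = (THE j. j < i \<and> {vs ! i, vs ! j} \<in> edges T)" for i
  have par: "par i < i \<and> {vs ! i, vs ! par i} \<in> edges T" if "1 \<le> i" "i < n" for i
    unfolding par_def by (rule theI') (use vs that in auto)
  have par': "j = par i" if "j < i" "i < n" "{vs ! i, vs ! j} \<in> edges T" for i j
    using vs that par[of i] by (auto dest!: bspec[where x = i])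
  show thesis by (rule that[OF _ \<open>set vs = verts T\<close> vs(1) par par']) (use vs in auto)
qed

lemma cyclic_shift_edges:
  assumes "\<And>x. x \<in> \<Union> (edges G) \<Longrightarrow> x < N" "\<And>e. e \<in> edges G \<Longrightarrow> card e = 2"
    and "e \<in> edges ((cyclic_shift N ^^ s) G)"
  shows "\<exists>x y. {x, y} \<in> edges G \<and> e = {(x + s) mod N, (y + s) mod N}"
  using assms(3)
proof (induction s arbitrary: e)
  case 0
  then have "e \<in> edges G" by simp
  then obtain x y where xy: "e = {x, y}" using assms(2)[of e] by (auto simp: card_2_iff)
  have "x < N" "y < N" using assms(1)[of x] assms(1)[of y] \<open>e \<in> edges G\<close> xy by auto
  then show ?case using \<open>e \<in> edges G\<close> xy by (intro exI[of _ x] exI[of _ y]) simp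
next
  case (Suc s)
  then have "e \<in> edges (cyclic_shift N ((cyclic_shift N ^^ s) G))" by simp
  then obtain x' y' where e: "e = {(x' + 1) mod N, (y' + 1) mod N}"
      "{x', y'} \<in> edges ((cyclic_shift N ^^ s) G)"
    unfolding cyclic_shift_def[of N "(cyclic_shift N ^^ s) G"] by auto
  then obtain x y where xy: "{x, y} \<in> edges G" "{x', y'} = {(x + s) mod N, (y + s) mod N}"
    using Suc.IH by blast
  have m: "((z + s) mod N + 1) mod N = (z + Suc s) mod N" for z by (simp add: mod_simps)
  have "e = (\<lambda>z. (z + 1) mod N) ` {x', y'}" using e by auto
  also have "\<dots> = {(x + Suc s) mod N, (y + Suc s) mod N}" unfolding xy(2) using m by simp
  finally show ?case using xy by blast
qed

text \<open>An edge lying in two shifts comes from two tree edges whose signed differences agree up to sign,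
  hence from a single tree edge. If the shifts carry equal ends to equal ends, they are the same shift.
  If they exchange the ends, twice the difference of the edge vanishes modulo N.\<close>
lemma packing_from_labels:
  fixes vs :: "'a list" and xs :: "int list"
  assumes T: "tree T" and vs: "distinct vs" "set vs = verts T" "length vs = n"
    and par: "\<And>i. 1 \<le> i \<Longrightarrow> i < n \<Longrightarrow> par i < i \<and> {vs ! i, vs ! par i} \<in> edges T"
    and par': "\<And>i j. j < i \<Longrightarrow> i < n \<Longrightarrow> {vs ! i, vs ! j} \<in> edges T \<Longrightarrow> j = par i"
    and xs: "length xs = n" "distinct xs" "set xs \<subseteq> {0..<int N}"
    and half: "\<And>i. 1 \<le> i \<Longrightarrow> i < n \<Longrightarrow> \<not> int N dvd 2 * (xs ! i - xs ! par i)"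
    and diff: "\<And>i j. 1 \<le> i \<Longrightarrow> i < j \<Longrightarrow> j < n \<Longrightarrow> \<not> int N dvd (xs ! j - xs ! par j) - (xs ! i - xs ! par i)"
    and summ: "\<And>i j. 1 \<le> i \<Longrightarrow> i < j \<Longrightarrow> j < n \<Longrightarrow> \<not> int N dvd (xs ! j - xs ! par j) + (xs ! i - xs ! par i)"
  shows "packs_cyclically T N"
proof -
  have sT: "simple_graph T" using T by (simp add: tree_def)
  define y where "y i = nat (xs ! i)" for i
  have xi: "0 \<le> xs ! i \<and> xs ! i < int N" if "i < n" for i using subsetD[OF xs(3) nth_mem[of i xs]] xs(1) that by simp
  have iy: "int (y i) = xs ! i" if "i < n" for i using xi[OF that] by (simp add: y_def)
  have yN: "y i < N" if "i < n" for i using xi[OF that] by (simp add: y_def nat_less_iff)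
  have yinj: "y i = y j \<longleftrightarrow> i = j" if "i < n" "j < n" for i j
    using that iy[of i] iy[of j] xs nth_eq_iff_index_eq[of xs i j] by auto
  define E where "E = {{y i, y (par i)} | i. 1 \<le> i \<and> i < n}"
  define T' where "T' = \<lparr>verts = y ` {..<n}, edges = E\<rparr>"
  have parn: "par i < n" "par i < i" if "1 \<le> i" "i < n" for i using par[OF that] that by auto
  have E2: "card e = 2 \<and> e \<subseteq> y ` {..<n}" if eE: "e \<in> E" for e
  proof -
    obtain i where i: "1 \<le> i" "i < n" "e = {y i, y (par i)}" using eE by (auto simp: E_def)
    then have "y i \<noteq> y (par i)" using parn[OF i(1,2)] yinj[of i "par i"] by auto
    then show ?thesis using i parn(1)[OF i(1,2)] by auto
  qed
  have sT': "simple_graph T'" using E2 by (auto simp: simple_graph_def T'_def)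
  have vN: "y ` {..<n} \<subseteq> {0..<N}" using yN by auto
  have "simple_graph (complete_graph N)" by (auto simp: simple_graph_def complete_graph_def)
  moreover have "edges T' \<subseteq> edges (complete_graph N)" "verts T' \<subseteq> verts (complete_graph N)"
    using E2 vN by (auto simp: T'_def complete_graph_def)
  ultimately have sub: "subgraph T' (complete_graph N)" using sT' by (auto simp: subgraph_def)
  have vinj: "vs ! i = vs ! j \<longleftrightarrow> i = j" if "i < n" "j < n" for i j
    using that vs nth_eq_iff_index_eq[of vs i j] by auto
  have edgeT: "{vs ! i, vs ! j} \<in> edges T \<longleftrightarrow> {y i, y j} \<in> E" if ij: "i < n" "j < n" for i j
  proof
    assume e: "{vs ! i, vs ! j} \<in> edges T"
    then have "i \<noteq> j" using sT by (auto simp: simple_graph_def)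
    then consider "j < i" | "i < j" by linarith
    then show "{y i, y j} \<in> E"
    proof cases
      case 1
      then have "j = par i" using par'[OF 1 ij(1) e] by simp
      then show ?thesis using 1 ij by (auto simp: E_def)
    next
      case 2
      then have "i = par j" using par'[OF 2 ij(2)] e by (simp add: insert_commute)
      then show ?thesis using 2 ij by (auto simp: E_def intro!: exI[of _ j])
    qed
  next
    assume "{y i, y j} \<in> E"
    then obtain k where k: "{y i, y j} = {y k, y (par k)}" "1 \<le> k" "k < n" by (auto simp: E_def)
    then have "(i = k \<and> j = par k) \<or> (i = par k \<and> j = k)"
      using parn[OF k(2,3)] ij yinj by (auto simp: doubleton_eq_iff)
    then show "{vs ! i, vs ! j} \<in> edges T" using par[OF k(2,3)] by (auto simp: insert_commute)
  qed
  define idx where "idx v = (THE i. i < n \<and> vs ! i = v)" for v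
  have idx: "idx (vs ! i) = i" if "i < n" for i unfolding idx_def by (rule the_equality) (use that vinj in auto)
  have vT: "verts T = (!) vs ` {..<n}" using vs by (auto simp: set_conv_nth)
  have "bij_betw (\<lambda>v. y (idx v)) (verts T) (verts T')"
    unfolding bij_betw_def
  proof
    show "inj_on (\<lambda>v. y (idx v)) (verts T)" unfolding vT using idx yinj by (auto intro!: inj_onI)
    show "(\<lambda>v. y (idx v)) ` verts T = verts T'" unfolding vT T'_def using idx by (auto simp: image_image)
  qed
  moreover have "{u, v} \<in> edges T \<longleftrightarrow> {y (idx u), y (idx v)} \<in> edges T'" if "u \<in> verts T" "v \<in> verts T" for u v
    using that edgeT idx unfolding vT T'_def by auto
  ultimately have iso: "graph_isomorphic T T'" unfolding graph_isomorphic_def by blast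
  have cong: "int N dvd (int a + int s) - (int b + int s')" if "(a + s) mod N = (b + s') mod N" for a b s s'
    using that by (metis mod_eq_dvd_iff of_nat_add of_nat_mod)
  have "disjoint_family_on (\<lambda>i. edges ((cyclic_shift N ^^ i) T')) {0..<N}"
    unfolding disjoint_family_on_def
  proof (intro ballI impI)
    fix s s' assume s: "s \<in> {0..<N}" "s' \<in> {0..<N}" "s \<noteq> s'"
    show "edges ((cyclic_shift N ^^ s) T') \<inter> edges ((cyclic_shift N ^^ s') T') = {}"
    proof (rule ccontr)
      assume "\<not> ?thesis"
      then obtain e where e: "e \<in> edges ((cyclic_shift N ^^ s) T')" "e \<in> edges ((cyclic_shift N ^^ s') T')" by auto
      have b: "x < N" if xT: "x \<in> \<Union> (edges T')" for x
      proof -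
        obtain f where "f \<in> E" "x \<in> f" using xT by (auto simp: T'_def)
        then have "x \<in> {0..<N}" using E2[of f] vN by blast
        then show ?thesis by simp
      qed
      have b2: "card f = 2" if "f \<in> edges T'" for f using E2[of f] that by (simp add: T'_def)
      have form: "\<exists>i. 1 \<le> i \<and> i < n \<and> e = {(y i + s) mod N, (y (par i) + s) mod N}"
        if es: "e \<in> edges ((cyclic_shift N ^^ s) T')" for s
      proof -
        obtain a b where ab: "{a, b} \<in> E" "e = {(a + s) mod N, (b + s) mod N}"
          using cyclic_shift_edges[OF b b2 es] by (auto simp: T'_def)
        then obtain i where "1 \<le> i" "i < n" "{a, b} = {y i, y (par i)}" by (auto simp: E_def)
        then show ?thesis using ab by (intro exI[of _ i]) (auto simp: doubleton_eq_iff)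
      qed
      obtain i where i: "1 \<le> i" "i < n" "e = {(y i + s) mod N, (y (par i) + s) mod N}" using form[OF e(1)] by auto
      obtain j where j: "1 \<le> j" "j < n" "e = {(y j + s') mod N, (y (par j) + s') mod N}" using form[OF e(2)] by auto
      note ii = iy[OF i(2)] iy[OF parn(1)[OF i(1,2)]] and jj = iy[OF j(2)] iy[OF parn(1)[OF j(1,2)]]
      have "(y i + s) mod N = (y j + s') mod N \<and> (y (par i) + s) mod N = (y (par j) + s') mod N \<or>
         (y i + s) mod N = (y (par j) + s') mod N \<and> (y (par i) + s) mod N = (y j + s') mod N"
        using i(3) j(3) by (auto simp: doubleton_eq_iff)
      then show False
      proof
        assume a: "(y i + s) mod N = (y j + s') mod N \<and> (y (par i) + s) mod N = (y (par j) + s') mod N"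
        have d1: "int N dvd (xs ! i + s) - (xs ! j + s')" "int N dvd (xs ! par i + s) - (xs ! par j + s')"
          using cong[of "y i" s "y j" s'] cong[of "y (par i)" s "y (par j)" s'] a ii jj by auto
        have d2: "int N dvd (xs ! i - xs ! par i) - (xs ! j - xs ! par j)"
          using dvd_diff[OF d1] by (simp add: algebra_simps)
        then have d3: "int N dvd (xs ! j - xs ! par j) - (xs ! i - xs ! par i)"
          using dvd_diff_commute by blast
        have "i = j" using d2 d3 diff[of i j] diff[of j i] i j by (metis linorder_neqE_nat)
        then have "int N dvd int s - int s'" using d1 by simp
        then have "int s = int s'" using s
          by (metis atLeastLessThan_iff mod_eq_dvd_iff mod_less of_nat_eq_iff of_nat_mod)
        then show False using s by simp
      next
        assume a: "(y i + s) mod N = (y (par j) + s') mod N \<and> (y (par i) + s) mod N = (y j + s') mod N"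
        have d1: "int N dvd (xs ! i + s) - (xs ! par j + s')" "int N dvd (xs ! par i + s) - (xs ! j + s')"
          using cong[of "y i" s "y (par j)" s'] cong[of "y (par i)" s "y j" s'] a ii jj by auto
        have d2: "int N dvd (xs ! i - xs ! par i) + (xs ! j - xs ! par j)"
          using dvd_diff[OF d1] by (simp add: algebra_simps)
        have "i = j" using d2 summ[of i j] summ[of j i] i j by (metis linorder_neqE_nat add.commute)
        then show False using d2 half[OF i(1,2)] by simp
      qed
    qed
  qed
  then show ?thesis using sub iso unfolding packs_cyclically_def by blast
qed

lemma few_children:
  assumes sT: "simple_graph T" and vs: "distinct vs" "set vs = verts T" "length vs = n"
    and par: "\<And>i. 1 \<le> i \<Longrightarrow> i < n \<Longrightarrow> par i < i \<and> {vs ! i, vs ! par i} \<in> edges T"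
  shows "card {i \<in> {1..<n}. par i = k} \<le> max_degree T"
proof (cases "k < n")
  case True
  have fe: "finite (edges T)" using sT by (intro finite_subset[of "edges T" "Pow (verts T)"]) (auto simp: simple_graph_def)
  have "card {i \<in> {1..<n}. par i = k} \<le> card {e \<in> edges T. vs ! k \<in> e}"
  proof (rule card_inj_on_le[where f = "\<lambda>i. {vs ! i, vs ! k}"])
    show "inj_on (\<lambda>i. {vs ! i, vs ! k}) {i \<in> {1..<n}. par i = k}"
      using vs True nth_eq_iff_index_eq[OF vs(1)] by (auto simp: inj_on_def doubleton_eq_iff)
    show "(\<lambda>i. {vs ! i, vs ! k}) ` {i \<in> {1..<n}. par i = k} \<subseteq> {e \<in> edges T. vs ! k \<in> e}"
      using par by auto
  qed (use fe in auto)
  also have "\<dots> = vertex_degree T (vs ! k)" by (simp add: vertex_degree_def)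
  also have "\<dots> \<le> max_degree T" unfolding max_degree_def
    using vs True sT by (intro Max_ge) (auto simp: simple_graph_def)
  finally show ?thesis .
next
  case False
  have "par i < n" if "1 \<le> i" "i < n" for i using par[OF that] that by auto
  then have "{i \<in> {1..<n}. par i = k} = {}" using False by auto
  then show ?thesis by (metis card.empty zero_le)
qed

section \<open>Patterns of unused differences and labels\<close>
text \<open>A form is a condition on a residue x. \<open>Difference a\<close> asks that x + a is an unused difference,
  \<open>LabelPlus b\<close> that x + b is an unused label, \<open>LabelMinus b\<close> that b - x is one. The unused
  differences are symmetric, so a reflected difference form would say nothing new. Reflected label
  forms do arise, because an edge uses up its difference together with the negative of it.\<close>
datatype form = Difference int | LabelPlus int | LabelMinus int

locale residues_mod =
  fixes N :: nat
  assumes N_pos: "N > 0"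
begin

abbreviation Z :: "int set" where "Z \<equiv> {0..<int N}"

fun holds :: "int set \<Rightarrow> int set \<Rightarrow> int \<Rightarrow> form \<Rightarrow> bool" where
  "holds U L x (Difference a) \<longleftrightarrow> (x + a) mod int N \<in> U"
| "holds U L x (LabelPlus b) \<longleftrightarrow> (x + b) mod int N \<in> L"
| "holds U L x (LabelMinus b) \<longleftrightarrow> (b - x) mod int N \<in> L"

definition forms :: "form set" where "forms = Difference ` Z \<union> LabelPlus ` Z \<union> LabelMinus ` Z"

definition solutions :: "int set \<Rightarrow> int set \<Rightarrow> form set \<Rightarrow> int set" where
  "solutions U L F = {x \<in> Z. \<forall>f\<in>F. holds U L x f}"

text \<open>The labels w whose choice below a parent labelled p makes a form fail at x: for a label form the
  label it asks for, for a difference form the two w with w - p equal to the difference up to sign.\<close>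
fun killers :: "int \<Rightarrow> int \<Rightarrow> form \<Rightarrow> int set" where
  "killers p x (Difference a) = {(p + x + a) mod int N, (p - x - a) mod int N}"
| "killers p x (LabelPlus b) = {(x + b) mod int N}"
| "killers p x (LabelMinus b) = {(b - x) mod int N}"

text \<open>When f holds at x, a killer of f at x is available below p exactly if the matching companion of f
  holds at x as well. So the number of available killers is expressed through larger patterns.\<close>
fun companions :: "int \<Rightarrow> form \<Rightarrow> form set" where
  "companions p (Difference a) = {LabelPlus ((p + a) mod int N), LabelMinus ((p - a) mod int N)}"
| "companions p (LabelPlus b) = {Difference ((b - p) mod int N)}"
| "companions p (LabelMinus b) = {Difference ((p - b) mod int N)}"

definition avail :: "int set \<Rightarrow> int set \<Rightarrow> int \<Rightarrow> int set" where
  "avail U L p = {w \<in> L. (w - p) mod int N \<in> U}"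

text \<open>Differences are used up in pairs u, -u. Without fixed points of negation, every step removes
  exactly two of them.\<close>
definition proper :: "int set \<Rightarrow> int set \<Rightarrow> bool" where
  "proper U L \<longleftrightarrow> U \<subseteq> Z \<and> L \<subseteq> Z \<and>
     (\<forall>u\<in>U. (- u) mod int N \<in> U \<and> (2 * u) mod int N \<noteq> 0)"

definition drop_diffs :: "int set \<Rightarrow> int \<Rightarrow> int \<Rightarrow> int set" where
  "drop_diffs U p w = U - {(w - p) mod int N, (p - w) mod int N}"

lemma mod_in_Z [simp]: "x mod int N \<in> Z"
  using N_pos by simp

lemma Z_mod_eq: "x \<in> Z \<Longrightarrow> x mod int N = x"
  by simp

lemma finite_forms: "finite forms" and card_forms: "card forms \<le> 3 * N"
proof -
  show "finite forms" by (simp add: forms_def)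
  have "card forms \<le> card (Difference ` Z \<union> LabelPlus ` Z) + card (LabelMinus ` Z)"
    unfolding forms_def by (rule card_Un_le)
  also have "\<dots> \<le> card (Difference ` Z) + card (LabelPlus ` Z) + card (LabelMinus ` Z)"
    using card_Un_le add_le_mono by blast
  also have "\<dots> \<le> card Z + card Z + card Z"
    by (intro add_mono card_image_le) auto
  finally show "card forms \<le> 3 * N" by simp
qed

lemma finite_solutions [simp]: "finite (solutions U L F)"
  unfolding solutions_def by (rule finite_subset[of _ Z]) auto

lemma card_solutions_le: "card (solutions U L F) \<le> N"
proof -
  have "card (solutions U L F) \<le> card Z" by (rule card_mono) (auto simp: solutions_def)
  then show ?thesis by simp
qed

lemma solutions_insert: "solutions U L (insert e F) = {x \<in> solutions U L F. holds U L x e}"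
  by (auto simp: solutions_def)

lemma companions_subset_forms: "companions p f \<subseteq> forms"
  using mod_in_Z by (cases f) (auto simp: forms_def simp del: atLeastLessThan_iff mod_in_Z)

lemma finite_companions [simp]: "finite (companions p f)" by (cases f) auto

lemma proper_uminus:
  assumes "proper U L" "x mod int N \<in> U" shows "(- x) mod int N \<in> U"
  using assms unfolding proper_def by (metis mod_minus_eq)

lemma proper_uminus_iff:
  assumes "proper U L" shows "(- x) mod int N \<in> U \<longleftrightarrow> x mod int N \<in> U"
  using proper_uminus[OF assms, of x] proper_uminus[OF assms, of "- x"] by auto

lemma holds_step:
  assumes "proper U L" "w \<in> avail U L p" "holds U L x f"
  shows "holds (drop_diffs U p w) (L - {w}) x f \<longleftrightarrow> w \<notin> killers p x f"
proof -
  have w: "w mod int N = w"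
    using assms unfolding proper_def avail_def by (intro Z_mod_eq) auto
  show ?thesis
  proof (cases f)
    case (Difference a)
    have "(x + a) mod int N = (w - p) mod int N \<longleftrightarrow> w mod int N = (p + x + a) mod int N"
      unfolding mod_eq_dvd_iff by (subst dvd_minus_iff[symmetric]) (simp add: algebra_simps)
    moreover have "(x + a) mod int N = (p - w) mod int N \<longleftrightarrow> w mod int N = (p - x - a) mod int N"
      unfolding mod_eq_dvd_iff by (simp add: algebra_simps)
    ultimately show ?thesis using Difference assms(3) w by (auto simp: drop_diffs_def)
  next
    case (LabelPlus b) then show ?thesis using assms(3) w by auto
  next
    case (LabelMinus b) then show ?thesis using assms(3) w by auto
  qed
qed

lemma card_killers_avail:
  assumes "proper U L" "holds U L x f"
  shows "card (killers p x f \<inter> avail U L p) = (\<Sum>e\<in>companions p f. if holds U L x e then 1 else 0)"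
proof (cases f)
  case (Difference a)
  let ?w1 = "(p + x + a) mod int N" and ?w2 = "(p - x - a) mod int N"
  have ua: "(x + a) mod int N \<in> U" using assms Difference by simp
  have ne: "?w1 \<noteq> ?w2"
  proof
    assume "?w1 = ?w2"
    then have "int N dvd 2 * (x + a)" unfolding mod_eq_dvd_iff by (simp add: algebra_simps)
    then have "(2 * ((x + a) mod int N)) mod int N = 0" by (simp add: mod_simps)
    with ua assms(1) show False by (auto simp: proper_def)
  qed
  have i1: "?w1 \<in> avail U L p \<longleftrightarrow> holds U L x (LabelPlus ((p + a) mod int N))"
  proof -
    have "(?w1 - p) mod int N = (x + a) mod int N" by (simp add: mod_simps)
    moreover have "(x + (p + a) mod int N) mod int N = ?w1" by (simp add: mod_simps algebra_simps)
    ultimately show ?thesis using ua by (simp add: avail_def)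
  qed
  have i2: "?w2 \<in> avail U L p \<longleftrightarrow> holds U L x (LabelMinus ((p - a) mod int N))"
  proof -
    have "(?w2 - p) mod int N = (- (x + a)) mod int N" by (simp add: mod_simps algebra_simps)
    then have "(?w2 - p) mod int N \<in> U" using proper_uminus[OF assms(1) ua] by simp
    moreover have "((p - a) mod int N - x) mod int N = ?w2" by (simp add: mod_simps algebra_simps)
    ultimately show ?thesis by (simp add: avail_def)
  qed
  have "killers p x f \<inter> avail U L p =
    (if ?w1 \<in> avail U L p then {?w1} else {}) \<union> (if ?w2 \<in> avail U L p then {?w2} else {})"
    using Difference by auto
  then have "card (killers p x f \<inter> avail U L p) =
    (if ?w1 \<in> avail U L p then 1 else 0) + (if ?w2 \<in> avail U L p then 1 else 0)"
    using ne by auto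
  then show ?thesis unfolding i1 i2 using Difference by simp
next
  case (LabelPlus b)
  let ?w = "(x + b) mod int N"
  have "(?w - p) mod int N = (x + (b - p) mod int N) mod int N" by (simp add: mod_simps algebra_simps)
  then have "?w \<in> avail U L p \<longleftrightarrow> holds U L x (Difference ((b - p) mod int N))"
    using assms LabelPlus by (simp add: avail_def)
  moreover have "killers p x f \<inter> avail U L p = (if ?w \<in> avail U L p then {?w} else {})"
    using LabelPlus by auto
  ultimately show ?thesis using LabelPlus by auto
next
  case (LabelMinus b)
  let ?w = "(b - x) mod int N"
  have "(?w - p) mod int N = (- (x + (p - b))) mod int N" by (simp add: mod_simps algebra_simps)
  moreover have "(x + (p - b) mod int N) mod int N = (x + (p - b)) mod int N" by (simp add: mod_simps)
  ultimately have "?w \<in> avail U L p \<longleftrightarrow> holds U L x (Difference ((p - b) mod int N))"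
    using assms LabelMinus proper_uminus_iff[OF assms(1), of "x + (p - b)"] by (simp add: avail_def)
  moreover have "killers p x f \<inter> avail U L p = (if ?w \<in> avail U L p then {?w} else {})"
    using LabelMinus by auto
  ultimately show ?thesis using LabelMinus by auto
qed

lemma finite_avail [simp]: "proper U L \<Longrightarrow> finite (avail U L p)"
  unfolding proper_def avail_def by (rule finite_subset[of _ Z]) auto

lemma sum_killers_avail:
  assumes "proper U L" "f \<in> F"
  shows "(\<Sum>x\<in>solutions U L F. card (killers p x f \<inter> avail U L p)) = (\<Sum>e\<in>companions p f. card (solutions U L (insert e F)))"
proof -
  have "(\<Sum>x\<in>solutions U L F. card (killers p x f \<inter> avail U L p))
      = (\<Sum>x\<in>solutions U L F. \<Sum>e\<in>companions p f. if holds U L x e then 1 else 0)"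
    using assms by (intro sum.cong refl card_killers_avail) (auto simp: solutions_def)
  also have "\<dots> = (\<Sum>e\<in>companions p f. \<Sum>x\<in>solutions U L F. if holds U L x e then 1 else 0)"
    by (rule sum.swap)
  also have "\<dots> = (\<Sum>e\<in>companions p f. card (solutions U L (insert e F)))"
    by (intro sum.cong refl) (simp add: solutions_insert sum.If_cases Int_def)
  finally show ?thesis .
qed

text \<open>Two solutions differ by a multiple of N / 2.\<close>
lemma card_double_le_2: "card {x \<in> Z. int N dvd 2 * x - k} \<le> 2"
proof (cases "{x \<in> Z. int N dvd 2 * x - k} = {}")
  case True then show ?thesis by (metis card.empty zero_le)
next
  case False
  define S where "S = {x \<in> Z. int N dvd 2 * x - k}"
  have fin: "finite S" unfolding S_def by (rule finite_subset[of _ Z]) auto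
  define m where "m = Min S"
  have mS: "m \<in> S" using False fin unfolding m_def S_def[symmetric] by (intro Min_in)
  have "S \<subseteq> {m, m + int N div 2}"
  proof
    fix y assume y: "y \<in> S"
    have my: "m \<le> y" using y fin by (simp add: m_def)
    have "int N dvd (2 * y - k) - (2 * m - k)" by (rule dvd_diff) (use y mS in \<open>simp_all add: S_def\<close>)
    then have "int N dvd 2 * (y - m)" by (simp add: algebra_simps)
    then obtain q where q: "2 * (y - m) = int N * q" by (auto elim: dvdE)
    have b: "0 \<le> y - m" "y - m < int N" using my y mS by (auto simp: S_def)
    have "2 * (y - m) < int N * 2" using b by simp
    then have "int N * q < int N * 2" unfolding q .
    then have "q < 2" using N_pos by (simp add: mult_less_cancel_left)
    moreover have "q \<ge> 0" using q b N_pos by (metis mult_nonneg_nonneg of_nat_0_less_iff zero_le_mult_iff zero_le_numeral not_less order_less_le)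
    ultimately have "q = 0 \<or> q = 1" by linarith
    then show "y \<in> {m, m + int N div 2}" using q N_pos by auto
  qed
  then have "card S \<le> card {m, m + int N div 2}" by (intro card_mono) auto
  also have "\<dots> \<le> 2" by (simp add: card_insert_if)
  finally show ?thesis by (simp add: S_def)
qed

definition clash :: "int \<Rightarrow> form \<Rightarrow> form \<Rightarrow> int set" where
  "clash p f f' = {x \<in> Z. killers p x f \<inter> killers p x f' \<noteq> {}}"

lemma clash_commute: "clash p f f' = clash p f' f" by (auto simp: clash_def)

lemma dvd_small: "\<lbrakk>a \<in> Z; b \<in> Z; int N dvd a - b\<rbrakk> \<Longrightarrow> a = b"
  by (metis Z_mod_eq mod_eq_dvd_iff)

text \<open>A common killer of two forms amounts to a linear equation for x. If neither form is a companion
  of the other, the equation is either unsolvable or has the form 2 * x = k.\<close>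
lemma card_clash:
  assumes "f \<in> forms" "f' \<in> forms" "f \<noteq> f'" "f' \<notin> companions p f" "f \<notin> companions p f'"
  shows "card (clash p f f') \<le> 2"
proof -
  have aux: "card (clash p f f') \<le> 2" if "clash p f f' \<subseteq> {x \<in> Z. int N dvd 2 * x - k}" for f f' k
  proof -
    have "card (clash p f f') \<le> card {x \<in> Z. int N dvd 2 * x - k}"
      by (rule card_mono[OF finite_subset[of _ Z]]) (use that in auto)
    with card_double_le_2[of k] show ?thesis by linarith
  qed
  have neg: "int N dvd a \<Longrightarrow> a = - b \<Longrightarrow> int N dvd b" for a b :: int by simp
  have DD: "card (clash p (Difference a) (Difference b)) \<le> 2" if "a \<in> Z" "b \<in> Z" "a \<noteq> b" for a b
  proof (rule aux[where k = "- a - b"], rule subsetI)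
    fix x assume "x \<in> clash p (Difference a) (Difference b)"
    moreover have "\<not> int N dvd a - b" "\<not> int N dvd b - a" using that dvd_small by blast+
    ultimately show "x \<in> {x \<in> Z. int N dvd 2 * x - (- a - b)}"
      by (auto simp: clash_def mod_eq_dvd_iff algebra_simps elim: neg)
  qed
  have PD: "card (clash p (LabelPlus b) (Difference a)) \<le> 2" if "a \<in> Z" "b \<in> Z" "a \<noteq> (b - p) mod int N" for a b
  proof (rule aux[where k = "p - a - b"], rule subsetI)
    fix x assume x: "x \<in> clash p (LabelPlus b) (Difference a)"
    have "a mod int N \<noteq> (b - p) mod int N" using that by simp
    then have "\<not> int N dvd a - (b - p)" by (simp add: mod_eq_dvd_iff)
    then have "\<not> int N dvd (x + b) - (p + x + a)" using dvd_minus_iff[of "int N" "a - (b - p)"] by (simp add: algebra_simps)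
    then show "x \<in> {x \<in> Z. int N dvd 2 * x - (p - a - b)}"
      using x by (auto simp: clash_def mod_eq_dvd_iff algebra_simps)
  qed
  have MD: "card (clash p (LabelMinus b) (Difference a)) \<le> 2" if "a \<in> Z" "b \<in> Z" "a \<noteq> (p - b) mod int N" for a b
  proof (rule aux[where k = "b - a - p"], rule subsetI)
    fix x assume x: "x \<in> clash p (LabelMinus b) (Difference a)"
    have "a mod int N \<noteq> (p - b) mod int N" using that by simp
    then have "\<not> int N dvd a - (p - b)" by (simp add: mod_eq_dvd_iff)
    then have n1: "\<not> int N dvd (b - x) - (p - x - a)" by (simp add: algebra_simps)
    have "(b - x) mod int N = (p + x + a) mod int N \<or> (b - x) mod int N = (p - x - a) mod int N"
      using x by (auto simp: clash_def)
    then have "int N dvd (b - x) - (p + x + a)" using n1 unfolding mod_eq_dvd_iff by blast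
    then have "int N dvd 2 * x - (b - a - p)" by (rule neg) (simp add: algebra_simps)
    then show "x \<in> {x \<in> Z. int N dvd 2 * x - (b - a - p)}"
      using x by (auto simp: clash_def)
  qed
  have PM: "card (clash p (LabelPlus b) (LabelMinus c)) \<le> 2" for b c
    by (rule aux[where k = "c - b"]) (auto simp: clash_def mod_eq_dvd_iff algebra_simps)
  have PP: "clash p (LabelPlus b) (LabelPlus c) = {}" if "b \<in> Z" "c \<in> Z" "b \<noteq> c" for b c
    using that dvd_small[of b c] dvd_small[of c b] by (auto simp: clash_def mod_eq_dvd_iff)
  have MM: "clash p (LabelMinus b) (LabelMinus c) = {}" if "b \<in> Z" "c \<in> Z" "b \<noteq> c" for b c
    using that dvd_small[of c b] by (auto simp: clash_def mod_eq_dvd_iff)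
  show ?thesis
    using assms DD PD MD PM PP MM clash_commute
    by (cases f; cases f') (force simp: forms_def)+
qed

end

text \<open>The change of the expected frequency of a pattern when the densities drop in one step, up to a
  second-order error.\<close>
lemma prod_diff_expand:
  fixes y h :: "'i \<Rightarrow> real"
  assumes "finite A" "\<And>i. i \<in> A \<Longrightarrow> 0 \<le> h i \<and> h i \<le> y i \<and> y i \<le> 1"
  shows "0 \<le> (\<Prod>i\<in>A. y i - h i) - ((\<Prod>i\<in>A. y i) - (\<Sum>i\<in>A. h i * (\<Prod>k\<in>A - {i}. y k)))"
    and "(\<Prod>i\<in>A. y i - h i) - ((\<Prod>i\<in>A. y i) - (\<Sum>i\<in>A. h i * (\<Prod>k\<in>A - {i}. y k))) \<le> (\<Sum>i\<in>A. h i)\<^sup>2"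
    and "(\<Prod>i\<in>A. y i) - (\<Prod>i\<in>A. y i - h i) \<le> (\<Sum>i\<in>A. h i)"
    and "0 \<le> (\<Prod>i\<in>A. y i) - (\<Prod>i\<in>A. y i - h i)"
proof -
  let ?S = "\<lambda>A. \<Sum>i\<in>A. h i * (\<Prod>k\<in>A - {i}. y k)"
  have "0 \<le> (\<Prod>i\<in>A. y i - h i) - ((\<Prod>i\<in>A. y i) - ?S A) \<and>
    (\<Prod>i\<in>A. y i - h i) - ((\<Prod>i\<in>A. y i) - ?S A) \<le> (\<Sum>i\<in>A. h i)\<^sup>2 \<and>
    (\<Prod>i\<in>A. y i) - (\<Prod>i\<in>A. y i - h i) \<le> (\<Sum>i\<in>A. h i) \<and>
    0 \<le> (\<Prod>i\<in>A. y i) - (\<Prod>i\<in>A. y i - h i)"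
    using assms
  proof (induction A rule: finite_induct)
    case empty then show ?case by simp
  next
    case (insert a A)
    define p q H T where "p = (\<Prod>i\<in>A. y i)" and "q = (\<Prod>i\<in>A. y i - h i)"
      and "H = (\<Sum>i\<in>A. h i)" and "T = ?S A"
    have IH: "0 \<le> q - (p - T)" "q - (p - T) \<le> H\<^sup>2" "p - q \<le> H" "0 \<le> p - q"
      using insert unfolding p_def q_def H_def T_def by auto
    have a: "0 \<le> h a" "h a \<le> y a" "y a \<le> 1" using insert.prems by auto
    have H0: "H \<ge> 0" unfolding H_def using insert.prems by (intro sum_nonneg) auto
    have p1: "0 \<le> p" "p \<le> 1" unfolding p_def using insert.prems by (force intro!: prod_nonneg prod_le_1)+
    have "(\<Sum>i\<in>A. h i * (\<Prod>k\<in>insert a A - {i}. y k)) = (\<Sum>i\<in>A. y a * (h i * (\<Prod>k\<in>A - {i}. y k)))"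
    proof (intro sum.cong refl)
      fix i assume "i \<in> A"
      then have "insert a A - {i} = insert a (A - {i})" using insert by auto
      then show "h i * (\<Prod>k\<in>insert a A - {i}. y k) = y a * (h i * (\<Prod>k\<in>A - {i}. y k))"
        using insert by simp
    qed
    then have S: "?S (insert a A) = h a * p + y a * T"
      using insert by (simp add: sum_distrib_left p_def T_def)
    have prods: "(\<Prod>i\<in>insert a A. y i) = y a * p" "(\<Prod>i\<in>insert a A. y i - h i) = (y a - h a) * q"
        "(\<Sum>i\<in>insert a A. h i) = h a + H"
      using insert by (simp_all add: p_def q_def H_def)
    have e: "(y a - h a) * q - (y a * p - (h a * p + y a * T))
       = y a * (q - (p - T)) + h a * (p - q)" by (simp add: algebra_simps)
    have "y a * (q - (p - T)) \<le> 1 * (q - (p - T))"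
      using a IH(1) by (intro mult_right_mono) auto
    then have u: "y a * (q - (p - T)) \<le> H\<^sup>2" "h a * (p - q) \<le> h a * H"
      using a IH(2,3) by (simp_all add: mult_left_mono)
    have n: "0 \<le> y a * (q - (p - T))" "0 \<le> h a * (p - q)" using a IH by auto
    have hh: "(h a + H)\<^sup>2 \<ge> H\<^sup>2 + h a * H" using a H0 by (simp add: power2_sum)
    have d: "y a * p - (y a - h a) * q = (y a - h a) * (p - q) + h a * p" by (simp add: algebra_simps)
    have "(y a - h a) * (p - q) \<le> 1 * H" using a IH by (intro mult_mono) auto
    moreover have "h a * p \<le> h a * 1" using a p1 by (intro mult_left_mono) auto
    moreover have "0 \<le> (y a - h a) * (p - q)" "0 \<le> h a * p" using a IH p1 by auto
    ultimately show ?case unfolding prods S e d using u n hh by linarith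
  qed
  then show "0 \<le> (\<Prod>i\<in>A. y i - h i) - ((\<Prod>i\<in>A. y i) - (\<Sum>i\<in>A. h i * (\<Prod>k\<in>A - {i}. y k)))"
    and "(\<Prod>i\<in>A. y i - h i) - ((\<Prod>i\<in>A. y i) - (\<Sum>i\<in>A. h i * (\<Prod>k\<in>A - {i}. y k))) \<le> (\<Sum>i\<in>A. h i)\<^sup>2"
    and "(\<Prod>i\<in>A. y i) - (\<Prod>i\<in>A. y i - h i) \<le> (\<Sum>i\<in>A. h i)"
    and "0 \<le> (\<Prod>i\<in>A. y i) - (\<Prod>i\<in>A. y i - h i)" by auto
qed

context residues_mod begin

definition density :: "int set \<Rightarrow> real" where "density U = card U / N"
fun weight :: "real \<Rightarrow> real \<Rightarrow> form \<Rightarrow> real" where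
  "weight u l (Difference a) = u" | "weight u l (LabelPlus a) = l" | "weight u l (LabelMinus a) = l"

text \<open>The proportion of x satisfying all forms of F if U and L were independent random sets of their
  densities. The deviation compares the true count with it.\<close>
definition expected :: "int set \<Rightarrow> int set \<Rightarrow> form set \<Rightarrow> real" where
  "expected U L F = (\<Prod>f\<in>F. weight (density U) (density L) f)"

definition deviation :: "int set \<Rightarrow> int set \<Rightarrow> form set \<Rightarrow> real" where
  "deviation U L F = card (solutions U L F) - N * expected U L F"

lemma card_le_N: "S \<subseteq> Z \<Longrightarrow> card S \<le> N"
  using card_mono[of Z S] by simp

lemma density_bounds: assumes "S \<subseteq> Z" shows "0 \<le> density S" "density S \<le> 1"
  using card_le_N[OF assms] N_pos by (auto simp: density_def)

lemma step_density:
  assumes pr: "proper U L" and w: "w \<in> avail U L p"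
  shows "proper (drop_diffs U p w) (L - {w})"
    and "density (drop_diffs U p w) = density U - 2 / N" and "density (L - {w}) = density L - 1 / N"
    and "2 / N \<le> density U" and "1 / N \<le> density L"
proof -
  have wp: "(w - p) mod int N \<in> U" and wL: "w \<in> L" using w by (auto simp: avail_def)
  have neg: "(p - w) mod int N = (- (w - p)) mod int N" by simp
  have pw: "(p - w) mod int N \<in> U" using proper_uminus[OF pr wp] by simp
  have ne: "(w - p) mod int N \<noteq> (p - w) mod int N"
  proof
    assume "(w - p) mod int N = (p - w) mod int N"
    then have "int N dvd 2 * (w - p)" unfolding mod_eq_dvd_iff by (simp add: algebra_simps)
    then have "(2 * ((w - p) mod int N)) mod int N = 0" by (simp add: mod_simps)
    with wp pr show False by (auto simp: proper_def)
  qed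
  have finU: "finite U" "finite L" using pr by (auto simp: proper_def intro: finite_subset[of _ Z])
  have sub: "{(w - p) mod int N, (p - w) mod int N} \<subseteq> U" using wp pw by auto
  have c2: "card {(w - p) mod int N, (p - w) mod int N} = 2" using ne by auto
  have cU: "card (drop_diffs U p w) = card U - 2" unfolding drop_diffs_def
    using card_Diff_subset[of "{(w - p) mod int N, (p - w) mod int N}" U] sub c2 by simp
  have geU: "card U \<ge> 2" using card_mono[OF finU(1) sub] c2 by simp
  have cL: "card (L - {w}) = card L - 1" "card L \<ge> 1" using wL finU
    by (auto simp: Suc_le_eq card_gt_0_iff)
  show "proper (drop_diffs U p w) (L - {w})"
    unfolding proper_def
  proof (intro conjI ballI)
    fix u assume u: "u \<in> drop_diffs U p w"
    then have uU: "u \<in> U" by (auto simp: drop_diffs_def)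
    then have uZ: "u mod int N = u" using pr by (intro Z_mod_eq) (auto simp: proper_def)
    have "(- u) mod int N \<noteq> (w - p) mod int N"
    proof
      assume "(- u) mod int N = (w - p) mod int N"
      then have "(- (- u)) mod int N = (- (w - p)) mod int N" by (rule mod_minus_cong)
      then show False using u uZ by (auto simp: drop_diffs_def)
    qed
    moreover have "(- u) mod int N \<noteq> (p - w) mod int N"
    proof
      assume "(- u) mod int N = (p - w) mod int N"
      then have "(- (- u)) mod int N = (- (p - w)) mod int N" by (rule mod_minus_cong)
      then show False using u uZ by (auto simp: drop_diffs_def)
    qed
    moreover have "(- u) mod int N \<in> U" using uU pr by (auto simp: proper_def)
    ultimately show "(- u) mod int N \<in> drop_diffs U p w" by (simp add: drop_diffs_def)
    show "2 * u mod int N \<noteq> 0" using uU pr by (auto simp: proper_def)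
  qed (use pr in \<open>auto simp: proper_def drop_diffs_def\<close>)
  show "density (drop_diffs U p w) = density U - 2 / N"
    using cU geU by (simp add: density_def of_nat_diff diff_divide_distrib)
  show "density (L - {w}) = density L - 1 / N"
    using cL by (simp add: density_def of_nat_diff diff_divide_distrib)
  show "2 / N \<le> density U" using geU by (simp add: density_def divide_right_mono)
  show "1 / N \<le> density L" using cL by (simp add: density_def divide_right_mono)
qed

lemma weight_diff: "weight (u - 2 / N) (l - 1 / N) f = weight u l f - weight (2 / N) (1 / N) f"
  by (cases f) auto

lemma sum_weight_le: assumes "finite F" shows "(\<Sum>f\<in>F. weight (2 / N) (1 / N) f) \<le> 2 * card F / N"
proof -
  have "(\<Sum>f\<in>F. weight (2 / N) (1 / N) f) \<le> (\<Sum>f\<in>F. 2 / N)"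
  proof (rule sum_mono)
    fix f show "weight (2 / N) (1 / N) f \<le> 2 / N" by (cases f) (auto simp: divide_right_mono)
  qed
  then show ?thesis by (simp add: mult.commute)
qed

lemma expected_step:
  assumes pr: "proper U L" and w: "w \<in> avail U L p" and F: "finite F"
  defines "U' \<equiv> drop_diffs U p w" and "L' \<equiv> L - {w}"
  shows "\<bar>expected U' L' F - expected U L F + (\<Sum>f\<in>F. weight (2 / N) (1 / N) f * expected U L (F - {f}))\<bar> \<le> (2 * card F / N)\<^sup>2"
    and "expected U' L' F \<le> expected U L F" and "expected U L F - expected U' L' F \<le> 2 * card F / N"
proof -
  note s = step_density[OF pr w]
  have b: "density U \<le> 1" "density L \<le> 1" using pr density_bounds by (auto simp: proper_def)
  let ?y = "weight (density U) (density L)" and ?h = "weight (2 / N) (1 / N)"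
  have y: "0 \<le> ?h f \<and> ?h f \<le> ?y f \<and> ?y f \<le> 1" for f using s b by (cases f) auto
  have n': "expected U' L' F = (\<Prod>f\<in>F. ?y f - ?h f)"
    unfolding expected_def U'_def L'_def s weight_diff ..
  have H: "(\<Sum>f\<in>F. ?h f) \<le> 2 * card F / N" by (rule sum_weight_le[OF F])
  have H0: "0 \<le> (\<Sum>f\<in>F. ?h f)" using y by (intro sum_nonneg) auto
  have H2: "(\<Sum>f\<in>F. ?h f)\<^sup>2 \<le> (2 * card F / N)\<^sup>2" using H H0 by (intro power_mono) auto
  note pe = prod_diff_expand[OF F, of ?h ?y, OF y]
  show "\<bar>expected U' L' F - expected U L F + (\<Sum>f\<in>F. weight (2 / N) (1 / N) f * expected U L (F - {f}))\<bar> \<le> (2 * card F / N)\<^sup>2"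
    using pe(1,2) H2 unfolding n' unfolding expected_def by linarith
  show "expected U' L' F \<le> expected U L F" "expected U L F - expected U' L' F \<le> 2 * card F / N"
    using pe(3,4) H unfolding n' unfolding expected_def by linarith+
qed

lemma expected_bounds:
  assumes "U \<subseteq> Z" "L \<subseteq> Z" shows "0 \<le> expected U L F" "expected U L F \<le> 1"
proof -
  have "0 \<le> weight (density U) (density L) f \<and> weight (density U) (density L) f \<le> 1" for f
    using density_bounds[OF assms(1)] density_bounds[OF assms(2)] by (cases f) auto
  then show "0 \<le> expected U L F" "expected U L F \<le> 1" unfolding expected_def
    by (auto intro!: prod_nonneg prod_le_1)
qed

lemma solutions_step:
  assumes "proper U L" "w \<in> avail U L p"
  shows "solutions (drop_diffs U p w) (L - {w}) F = {x \<in> solutions U L F. w \<notin> (\<Union>f\<in>F. killers p x f)}"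
proof -
  have mono: "holds (drop_diffs U p w) (L - {w}) x f \<Longrightarrow> holds U L x f" for x f
    by (cases f) (auto simp: drop_diffs_def)
  show ?thesis unfolding solutions_def using holds_step[OF assms] mono by blast
qed

lemma card_killers_le: "card (killers p x f) \<le> 2" and finite_killers [simp]: "finite (killers p x f)"
  by (cases f; simp add: card_insert_if)+

text \<open>Double counting of the pairs of an available label and a solution that it destroys.\<close>
lemma sum_loss:
  assumes pr: "proper U L"
  shows "(\<Sum>w\<in>avail U L p. card (solutions U L F) - card (solutions (drop_diffs U p w) (L - {w}) F))
       = (\<Sum>x\<in>solutions U L F. card ((\<Union>f\<in>F. killers p x f) \<inter> avail U L p))"
proof -
  have "card (solutions U L F) - card (solutions (drop_diffs U p w) (L - {w}) F)
      = (\<Sum>x\<in>solutions U L F. if w \<in> (\<Union>f\<in>F. killers p x f) then 1 else 0)" if w: "w \<in> avail U L p" for w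
  proof -
    have "solutions U L F - solutions (drop_diffs U p w) (L - {w}) F = {x \<in> solutions U L F. w \<in> (\<Union>f\<in>F. killers p x f)}"
      unfolding solutions_step[OF pr w] by blast
    moreover have "solutions (drop_diffs U p w) (L - {w}) F \<subseteq> solutions U L F" unfolding solutions_step[OF pr w] by blast
    ultimately have "card (solutions U L F) - card (solutions (drop_diffs U p w) (L - {w}) F) = card {x \<in> solutions U L F. w \<in> (\<Union>f\<in>F. killers p x f)}"
      using card_Diff_subset[of "solutions (drop_diffs U p w) (L - {w}) F" "solutions U L F"] by simp
    then show ?thesis by (simp add: sum.If_cases Int_def)
  qed
  then have "(\<Sum>w\<in>avail U L p. card (solutions U L F) - card (solutions (drop_diffs U p w) (L - {w}) F))
    = (\<Sum>w\<in>avail U L p. \<Sum>x\<in>solutions U L F. if w \<in> (\<Union>f\<in>F. killers p x f) then 1 else 0)"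
    by (intro sum.cong refl) auto
  also have "\<dots> = (\<Sum>x\<in>solutions U L F. \<Sum>w\<in>avail U L p. if w \<in> (\<Union>f\<in>F. killers p x f) then 1 else 0)"
    by (rule sum.swap)
  also have "\<dots> = (\<Sum>x\<in>solutions U L F. card ((\<Union>f\<in>F. killers p x f) \<inter> avail U L p))"
    proof (intro sum.cong refl)
    fix x
    have "avail U L p \<inter> {w. w \<in> (\<Union>f\<in>F. killers p x f)} = (\<Union>f\<in>F. killers p x f) \<inter> avail U L p" by blast
    then show "(\<Sum>w\<in>avail U L p. if w \<in> (\<Union>f\<in>F. killers p x f) then 1 else 0) =
        card ((\<Union>f\<in>F. killers p x f) \<inter> avail U L p)"
      using pr by (simp only: sum.If_cases[OF finite_avail] sum_constant) simp
  qed
  finally show ?thesis .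
qed

text \<open>A companion of f that already lies in F adds no condition to F, so that its pattern is more frequent
  than a pattern with one more form should be. For clean labels p this does not happen.\<close>
definition clean :: "form set \<Rightarrow> int \<Rightarrow> bool" where
  "clean F p \<longleftrightarrow> (\<forall>f\<in>F. companions p f \<inter> F = {})"

text \<open>A solution has as many available killers as companions hold at it, provided that no label kills two
  of its forms. A shared killer occurs for at most two x per pair of forms, and then the two counts differ
  by at most twice the number of forms.\<close>
lemma sum_loss_approx:
  assumes pr: "proper U L" and F: "F \<subseteq> forms" "clean F p"
  defines "A \<equiv> \<Sum>w\<in>avail U L p. card (solutions U L F) - card (solutions (drop_diffs U p w) (L - {w}) F)"
    and "B \<equiv> \<Sum>f\<in>F. \<Sum>e\<in>companions p f. card (solutions U L (insert e F))"
  shows "A \<le> B" "B \<le> A + 4 * card F ^ 3"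
proof -
  have fin: "finite F" using F finite_forms finite_subset by blast
  define av where "av = avail U L p"
  have fav: "finite av" unfolding av_def using pr by simp
  define lo where "lo x = card ((\<Union>f\<in>F. killers p x f) \<inter> av)" for x
  define hi where "hi x = (\<Sum>f\<in>F. card (killers p x f \<inter> av))" for x
  define bad where "bad = (\<Union>(f,f')\<in>{(f,f'). f \<in> F \<and> f' \<in> F \<and> f \<noteq> f'}. clash p f f')"
  have A: "A = (\<Sum>x\<in>solutions U L F. lo x)" unfolding A_def sum_loss[OF pr] lo_def av_def ..
  have B: "B = (\<Sum>x\<in>solutions U L F. hi x)"
  proof -
    have "B = (\<Sum>f\<in>F. \<Sum>x\<in>solutions U L F. card (killers p x f \<inter> av))"
      unfolding B_def av_def using sum_killers_avail[OF pr] by (intro sum.cong refl) auto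
    also have "\<dots> = (\<Sum>x\<in>solutions U L F. hi x)" unfolding hi_def by (rule sum.swap)
    finally show ?thesis .
  qed
  have U: "(\<Union>f\<in>F. killers p x f) \<inter> av = (\<Union>f\<in>F. killers p x f \<inter> av)" for x by auto
  have lohi: "lo x \<le> hi x" for x unfolding lo_def hi_def U by (rule card_UN_le[OF fin])
  then show "A \<le> B" unfolding A B by (rule sum_mono)
  have eq: "hi x = lo x" if "x \<in> solutions U L F" "x \<notin> bad" for x
    unfolding lo_def hi_def U
  proof (rule card_UN_disjoint[symmetric, OF fin])
    have xZ: "x \<in> Z" using that by (auto simp: solutions_def)
    show "\<forall>i\<in>F. \<forall>j\<in>F. i \<noteq> j \<longrightarrow> killers p x i \<inter> av \<inter> (killers p x j \<inter> av) = {}"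
    proof (intro ballI impI)
      fix i j assume "i \<in> F" "j \<in> F" "i \<noteq> j"
      then have "x \<notin> clash p i j" using that(2) by (auto simp: bad_def)
      then show "killers p x i \<inter> av \<inter> (killers p x j \<inter> av) = {}" using xZ by (auto simp: clash_def)
    qed
  qed (use fin in auto)
  have hi2: "hi x \<le> 2 * card F" for x
  proof -
    have "hi x \<le> (\<Sum>f\<in>F. 2)" unfolding hi_def
      by (intro sum_mono order_trans[OF card_mono card_killers_le]) auto
    then show ?thesis by simp
  qed
  have fp: "finite {(f,f'). f \<in> F \<and> f' \<in> F \<and> f \<noteq> f'}" by (rule finite_subset[of _ "F \<times> F"]) (use fin in auto)
  have cb: "card bad \<le> 2 * card F ^ 2"
  proof -
    have "card bad \<le> (\<Sum>q\<in>{(f,f'). f \<in> F \<and> f' \<in> F \<and> f \<noteq> f'}. card (case q of (f,f') \<Rightarrow> clash p f f'))"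
      unfolding bad_def by (rule card_UN_le[OF fp])
    also have "\<dots> \<le> (\<Sum>q\<in>{(f,f'). f \<in> F \<and> f' \<in> F \<and> f \<noteq> f'}. 2)"
    proof (rule sum_mono)
      fix q assume "q \<in> {(f,f'). f \<in> F \<and> f' \<in> F \<and> f \<noteq> f'}"
      then obtain f f' where q: "q = (f,f')" "f \<in> F" "f' \<in> F" "f \<noteq> f'" by auto
      then have "f' \<notin> companions p f" "f \<notin> companions p f'" using F by (auto simp: clean_def)
      with q F show "card (case q of (f,f') \<Rightarrow> clash p f f') \<le> 2" by (auto intro!: card_clash)
    qed
    also have "\<dots> = 2 * card {(f,f'). f \<in> F \<and> f' \<in> F \<and> f \<noteq> f'}" by simp
    also have "\<dots> \<le> 2 * card (F \<times> F)" by (intro mult_left_mono card_mono) (use fin in auto)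
    finally show ?thesis by (simp add: card_cartesian_product power2_eq_square)
  qed
  have fb: "finite bad" unfolding bad_def using fp
    by (auto simp: clash_def intro!: finite_subset[of _ Z])
  have "B \<le> (\<Sum>x\<in>solutions U L F. lo x + (if x \<in> bad then 2 * card F else 0))"
    unfolding B by (intro sum_mono) (use eq hi2 in \<open>auto intro: order_trans[OF hi2]\<close>)
  also have "\<dots> = A + 2 * card F * card (solutions U L F \<inter> bad)"
    unfolding A by (simp add: sum.distrib sum.If_cases)
  also have "\<dots> \<le> A + 2 * card F * (2 * card F ^ 2)"
    using card_mono[OF fb, of "solutions U L F \<inter> bad"] cb by (intro add_left_mono mult_left_mono) auto
  finally show "B \<le> A + 4 * card F ^ 3" by (simp add: power2_eq_square power3_eq_cube algebra_simps)
qed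

text \<open>Each pair of forms rules out at most one p.\<close>
lemma card_unclean:
  assumes "F \<subseteq> forms" shows "card {p \<in> Z. \<not> clean F p} \<le> (card F)\<^sup>2"
proof -
  have fin: "finite F" using assms finite_forms finite_subset by blast
  have one: "card {p \<in> Z. f' \<in> companions p f} \<le> 1" if "f \<in> forms" "f' \<in> forms" for f f'
  proof -
    have "p = q" if h: "p \<in> Z" "q \<in> Z" "f' \<in> companions p f" "f' \<in> companions q f" for p q
    proof (cases f)
      case (Difference a)
      have "(p + a) mod int N = (q + a) mod int N \<or> (p - a) mod int N = (q - a) mod int N"
        using h Difference by auto
      then show ?thesis using h by (auto simp: mod_eq_dvd_iff dvd_small)
    next
      case (LabelPlus b)
      then have "(b - p) mod int N = (b - q) mod int N" using h by auto
      then show ?thesis using h dvd_small[of q p] by (auto simp: mod_eq_dvd_iff)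
    next
      case (LabelMinus b)
      then have "(p - b) mod int N = (q - b) mod int N" using h by auto
      then show ?thesis using h by (auto simp: mod_eq_dvd_iff dvd_small)
    qed
    moreover have "finite {p \<in> Z. f' \<in> companions p f}" by (rule finite_subset[of _ Z]) auto
    ultimately show ?thesis using card_le_Suc0_iff_eq[of "{p \<in> Z. f' \<in> companions p f}"] by auto
  qed
  have "{p \<in> Z. \<not> clean F p} = (\<Union>(f,f')\<in>F \<times> F. {p \<in> Z. f' \<in> companions p f})"
    by (auto simp: clean_def)
  then have "card {p \<in> Z. \<not> clean F p} \<le> (\<Sum>q\<in>F \<times> F. card (case q of (f,f') \<Rightarrow> {p \<in> Z. f' \<in> companions p f}))"
    using card_UN_le[of "F \<times> F"] fin by auto
  also have "\<dots> \<le> (\<Sum>q\<in>F \<times> F. 1)"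
    by (rule sum_mono) (use one assms in auto)
  finally show ?thesis by (simp add: card_cartesian_product power2_eq_square)
qed

end

context residues_mod begin

lemma avail_eq_solutions:
  assumes "proper U L"
  shows "avail U L p = solutions U L {LabelPlus 0, Difference ((- p) mod int N)}"
proof -
  have "(x + (- p) mod int N) mod int N = (x - p) mod int N" for x by (simp add: mod_simps)
  then show ?thesis using assms by (auto simp: avail_def solutions_def proper_def)
qed

lemma card_avail_deviation:
  assumes "proper U L"
  shows "real (card (avail U L p)) = N * (density U * density L) + deviation U L {LabelPlus 0, Difference ((- p) mod int N)}"
  unfolding avail_eq_solutions[OF assms] deviation_def expected_def by simp

lemma expected_insert_companions:
  assumes "finite F" "f \<in> F" "e \<in> companions p f" "clean F p"
  shows "expected U L (insert e F) = density U * density L * expected U L (F - {f})"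
proof -
  have "e \<notin> F" using assms by (auto simp: clean_def)
  then have "expected U L (insert e F) = weight (density U) (density L) e * (weight (density U) (density L) f * expected U L (F - {f}))"
    using assms unfolding expected_def by (simp add: prod.remove)
  moreover have "weight (density U) (density L) e * weight (density U) (density L) f = density U * density L"
    using assms(3) by (cases f) auto
  ultimately show ?thesis by simp
qed

lemma sum_companions_const: "(\<Sum>e\<in>companions p f. x) = N * (weight (2 / N) (1 / N) f * x)" for x :: real
  using N_pos by (cases f) auto

lemma card_companions_le: "card (companions p f) \<le> 2"
  by (cases f) auto

text \<open>The average over the available labels of the change of a deviation. If the enlarged patterns and the
  number of available labels had their expected sizes, the average loss of solutions would equal, up to
  second-order terms, the loss of the expected count: a difference form has two companions, matching the
  two differences used up in a step. So only the deviations of patterns with one more form, and of the pattern that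
  counts the available labels, contribute.\<close>
lemma clean_drift:
  fixes g eps :: real
  assumes pr: "proper U L" and F: "F \<subseteq> forms" "clean F p" "F \<noteq> {}"
    and g: "0 < g" "g \<le> 1" and eps: "0 \<le> eps"
    and deviation_companions: "\<And>f e. f \<in> F \<Longrightarrow> e \<in> companions p f \<Longrightarrow> \<bar>deviation U L (insert e F)\<bar> \<le> eps * N"
    and deviation_av: "\<bar>deviation U L {LabelPlus 0, Difference ((- p) mod int N)}\<bar> \<le> eps * N"
    and many: "N * g / 2 \<le> card (avail U L p)"
  shows "\<bar>\<Sum>w\<in>avail U L p. deviation (drop_diffs U p w) (L - {w}) F - deviation U L F\<bar>
    \<le> card (avail U L p) * (8 * real (card F) * eps / g + 12 * real (card F) ^ 3 / (g * N))"
proof -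
  have fin: "finite F" using F finite_forms finite_subset by blast
  define c where "c = real (card (avail U L p))"
  define j where "j = real (card F)"
  have j1: "1 \<le> j" using F fin unfolding j_def
    by (metis One_nat_def Suc_leI card_gt_0_iff of_nat_1 of_nat_mono)
  have UL: "U \<subseteq> Z" "L \<subseteq> Z" using pr by (auto simp: proper_def)
  define S where "S = (\<Sum>f\<in>F. weight (2 / N) (1 / N) f * expected U L (F - {f}))"
  define A where "A = (\<Sum>w\<in>avail U L p. card (solutions U L F) - card (solutions (drop_diffs U p w) (L - {w}) F))"
  define B where "B = (\<Sum>f\<in>F. \<Sum>e\<in>companions p f. card (solutions U L (insert e F)))"
  have N0: "real N > 0" using N_pos by simp
  have c0: "N * g / 2 \<le> c" using many by (simp add: c_def)
  have "0 < N * g / 2" using N0 g by simp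
  then have cpos: "c > 0" using c0 by linarith
  have AB: "real A \<le> B" "real B \<le> A + 4 * j ^ 3"
  proof -
    have *: "A \<le> B" "B \<le> A + 4 * card F ^ 3"
      unfolding A_def B_def by (rule sum_loss_approx[OF pr F(1,2)])+
    show "real A \<le> B" using *(1) by simp
    have "real B \<le> real (A + 4 * card F ^ 3)" using *(2) by (rule of_nat_mono)
    then show "real B \<le> A + 4 * j ^ 3" by (simp add: j_def)
  qed
  have sumA: "(\<Sum>w\<in>avail U L p. real (card (solutions (drop_diffs U p w) (L - {w}) F)) - card (solutions U L F)) = - real A"
  proof -
    have "real (card (solutions (drop_diffs U p w) (L - {w}) F)) - card (solutions U L F)
       = - real (card (solutions U L F) - card (solutions (drop_diffs U p w) (L - {w}) F))" if "w \<in> avail U L p" for w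
    proof -
      have "card (solutions (drop_diffs U p w) (L - {w}) F) \<le> card (solutions U L F)"
        by (rule card_mono) (auto simp: solutions_step[OF pr that])
      then show ?thesis by (simp add: of_nat_diff)
    qed
    then show ?thesis unfolding A_def by (simp add: sum_negf)
  qed
  have dB: "\<bar>real B - c * N * S\<bar> \<le> c * (8 * j * eps / g)"
  proof -
    have one: "\<bar>real (card (solutions U L (insert e F))) - c * expected U L (F - {f})\<bar> \<le> 4 * c * eps / g"
      if f: "f \<in> F" and e: "e \<in> companions p f" for f e
    proof -
      have "real (card (solutions U L (insert e F))) - c * expected U L (F - {f})
        = deviation U L (insert e F) - deviation U L {LabelPlus 0, Difference ((- p) mod int N)} * expected U L (F - {f})"
        unfolding c_def card_avail_deviation[OF pr] deviation_def[of _ _ "insert e F"] expected_insert_companions[OF fin f e F(2)]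
        by (simp add: algebra_simps)
      also have "\<bar>\<dots>\<bar> \<le> \<bar>deviation U L (insert e F)\<bar> + \<bar>deviation U L {LabelPlus 0, Difference ((- p) mod int N)}\<bar> * expected U L (F - {f})"
        using expected_bounds(1)[OF UL, of "F - {f}"]
        by (metis (no_types, opaque_lifting) abs_mult abs_of_nonneg abs_triangle_ineq4)
      also have "\<dots> \<le> eps * N + eps * N * 1"
        using deviation_companions[OF f e] deviation_av expected_bounds[OF UL, of "F - {f}"] eps by (intro add_mono mult_mono) auto
      also have "\<dots> = 2 * eps * N" by simp
      also have "\<dots> \<le> 4 * c * eps / g"
      proof -
        have "N \<le> 2 * c / g" using c0 g by (simp add: field_simps)
        then have "2 * eps * N \<le> 2 * eps * (2 * c / g)" using eps by (intro mult_left_mono) auto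
        then show ?thesis by (simp add: mult_ac)
      qed
      finally show ?thesis .
    qed
    have "c * N * S = (\<Sum>f\<in>F. \<Sum>e\<in>companions p f. c * expected U L (F - {f}))"
      unfolding S_def by (simp only: sum_companions_const) (simp add: sum_distrib_left algebra_simps)
    then have "real B - c * N * S
      = (\<Sum>f\<in>F. \<Sum>e\<in>companions p f. real (card (solutions U L (insert e F))) - c * expected U L (F - {f}))"
      unfolding B_def by (simp add: sum_subtractf)
    also have "\<bar>\<dots>\<bar> \<le> (\<Sum>f\<in>F. \<Sum>e\<in>companions p f. \<bar>real (card (solutions U L (insert e F))) - c * expected U L (F - {f})\<bar>)"
      by (rule order_trans[OF sum_abs]) (intro sum_mono sum_abs)
    also have "\<dots> \<le> (\<Sum>f\<in>F. \<Sum>e\<in>companions p f. 4 * c * eps / g)"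
      by (intro sum_mono one)
    also have "\<dots> \<le> (\<Sum>f\<in>F. 2 * (4 * c * eps / g))"
    proof (rule sum_mono)
      fix f
      have "real (card (companions p f)) * (4 * c * eps / g) \<le> 2 * (4 * c * eps / g)"
        using card_companions_le[of p f] cpos eps g by (intro mult_right_mono) auto
      then show "(\<Sum>e\<in>companions p f. 4 * c * eps / g) \<le> 2 * (4 * c * eps / g)" by simp
    qed
    also have "\<dots> = c * (8 * j * eps / g)" by (simp add: j_def)
    finally show ?thesis .
  qed
  have dN: "\<bar>(\<Sum>w\<in>avail U L p. expected (drop_diffs U p w) (L - {w}) F - expected U L F) + c * S\<bar> \<le> c * (2 * j / N)\<^sup>2"
  proof -
    have "(\<Sum>w\<in>avail U L p. expected (drop_diffs U p w) (L - {w}) F - expected U L F) + c * S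
      = (\<Sum>w\<in>avail U L p. expected (drop_diffs U p w) (L - {w}) F - expected U L F + S)"
      by (simp add: sum.distrib c_def)
    also have "\<bar>\<dots>\<bar> \<le> (\<Sum>w\<in>avail U L p. (2 * j / N)\<^sup>2)"
      by (rule order_trans[OF sum_abs sum_mono]) (use expected_step(1)[OF pr _ fin] in \<open>auto simp: S_def j_def\<close>)
    finally show ?thesis by (simp add: c_def)
  qed
  define Q where "Q = (\<Sum>w\<in>avail U L p. expected (drop_diffs U p w) (L - {w}) F - expected U L F)"
  have "(\<Sum>w\<in>avail U L p. deviation (drop_diffs U p w) (L - {w}) F - deviation U L F) = - real A - N * Q"
    unfolding Q_def sumA[symmetric] deviation_def sum_distrib_left sum_subtractf[symmetric]
    by (intro sum.cong refl) (simp add: algebra_simps)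
  also have "\<dots> = (real B - real A) - (real B - c * N * S) - N * (Q + c * S)" by (simp add: algebra_simps)
  also have "\<bar>\<dots>\<bar> \<le> 4 * j ^ 3 + c * (8 * j * eps / g) + N * (c * (2 * j / N)\<^sup>2)"
  proof -
    have "\<bar>N * (Q + c * S)\<bar> \<le> N * (c * (2 * j / N)\<^sup>2)"
      using dN N0 by (simp add: abs_mult Q_def)
    then show ?thesis using dB AB by linarith
  qed
  also have "\<dots> \<le> c * (8 * j * eps / g + 12 * j ^ 3 / (g * N))"
  proof -
    have "4 * j ^ 3 = (N * g / 2) * (8 * j ^ 3 / (g * N))" using N0 g by (simp add: field_simps)
    also have "\<dots> \<le> c * (8 * j ^ 3 / (g * N))" using c0 N0 g j1 by (intro mult_right_mono) auto
    finally have 1: "4 * j ^ 3 \<le> c * (8 * j ^ 3 / (g * N))" .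
    have "N * (c * (2 * j / N)\<^sup>2) = c * (4 * j ^ 2 / N)" using N0 by (simp add: power2_eq_square field_simps)
    also have "\<dots> \<le> c * (4 * j ^ 3 / (g * N))"
    proof (intro mult_left_mono)
      have "j ^ 2 * g \<le> j ^ 3 * 1" using j1 g by (intro mult_mono power_increasing) auto
      then show "4 * j ^ 2 / N \<le> 4 * j ^ 3 / (g * N)" using N0 g by (simp add: field_simps)
    qed (use cpos in auto)
    finally have 2: "N * (c * (2 * j / N)\<^sup>2) \<le> c * (4 * j ^ 3 / (g * N))" .
    have "c * (8 * j * eps / g + 12 * j ^ 3 / (g * N))
      = c * (8 * j * eps / g) + c * (8 * j ^ 3 / (g * N)) + c * (4 * j ^ 3 / (g * N))"
      by (simp add: algebra_simps add_divide_distrib[symmetric])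
    with 1 2 show ?thesis by linarith
  qed
  finally show ?thesis by (simp add: c_def j_def)
qed

lemma deviation_step_bound:
  assumes pr: "proper U L" and w: "w \<in> avail U L p" and F: "finite F"
  shows "\<bar>deviation (drop_diffs U p w) (L - {w}) F - deviation U L F\<bar> \<le> 2 * card F"
proof -
  let ?s' = "solutions (drop_diffs U p w) (L - {w}) F"
  have sub: "?s' \<subseteq> solutions U L F" by (auto simp: solutions_step[OF pr w])
  have "solutions U L F - ?s' \<subseteq> (\<Union>f\<in>F. {x \<in> Z. w \<in> killers p x f})"
    unfolding solutions_step[OF pr w] by (auto simp: solutions_def)
  then have "card (solutions U L F - ?s') \<le> card (\<Union>f\<in>F. {x \<in> Z. w \<in> killers p x f})"
    using F by (intro card_mono) (auto intro!: finite_subset[of _ Z])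
  also have "\<dots> \<le> (\<Sum>f\<in>F. card {x \<in> Z. w \<in> killers p x f})" by (rule card_UN_le[OF F])
  also have "\<dots> \<le> (\<Sum>f\<in>F. 2)"
  proof (rule sum_mono)
    fix f
    have "{x \<in> Z. w \<in> killers p x f} \<subseteq> (case f of Difference a \<Rightarrow> {(w - (p + a)) mod int N, (p - a - w) mod int N}
      | LabelPlus b \<Rightarrow> {(w - b) mod int N} | LabelMinus b \<Rightarrow> {(b - w) mod int N})" (is "_ \<subseteq> ?K")
    proof
      fix x assume "x \<in> {x \<in> Z. w \<in> killers p x f}"
      then show "x \<in> ?K" by (cases f) (auto simp: mod_simps)
    qed
    then have "card {x \<in> Z. w \<in> killers p x f} \<le> card ?K"
      by (intro card_mono) (auto split: form.split)
    also have "\<dots> \<le> 2" by (auto split: form.split simp: card_insert_if)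
    finally show "card {x \<in> Z. w \<in> killers p x f} \<le> 2" .
  qed
  finally have "card (solutions U L F - ?s') \<le> 2 * card F" by simp
  then have 1: "real (card (solutions U L F)) - card ?s' \<le> 2 * card F" "real (card ?s') \<le> card (solutions U L F)"
    using card_Diff_subset[OF finite_solutions sub] card_mono[OF finite_solutions sub] by linarith+
  have N0: "real N > 0" using N_pos by simp
  note ns = expected_step(2,3)[OF pr w F]
  have 2: "0 \<le> N * expected U L F - N * expected (drop_diffs U p w) (L - {w}) F"
    using ns(1) N0 by simp
  have "N * (expected U L F - expected (drop_diffs U p w) (L - {w}) F) \<le> N * (2 * card F / N)"
    by (rule mult_left_mono[OF ns(2)]) simp
  then have 3: "N * expected U L F - N * expected (drop_diffs U p w) (L - {w}) F \<le> 2 * card F"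
    using N0 by (simp add: right_diff_distrib)
  show ?thesis using 1 2 3 unfolding deviation_def by linarith
qed

end

section \<open>Derandomised choice\<close>
lemma exp_le_quadratic:
  fixes y :: real assumes "\<bar>y\<bar> \<le> 1" shows "exp y \<le> 1 + y + y\<^sup>2"
proof (cases "y \<ge> 0")
  case True then show ?thesis using assms by (intro exp_bound) auto
next
  case False
  define z where "z = - y"
  have z: "0 < z" "z \<le> 1" using False assms by (auto simp: z_def)
  have 1: "1 + z + z\<^sup>2 / 2 \<le> exp z" by (rule exp_lower_Taylor_quadratic) (use z in auto)
  have "1 \<le> (1 - z + z\<^sup>2) * (1 + z + z\<^sup>2 / 2)"
  proof -
    have "(1 - z + z\<^sup>2) * (1 + z + z\<^sup>2 / 2) = 1 + (z\<^sup>2 + z ^ 3 + z ^ 4) / 2"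
      by (simp add: power2_eq_square power3_eq_cube power4_eq_xxxx field_simps)
    then show ?thesis using z by simp
  qed
  also have "\<dots> \<le> (1 - z + z\<^sup>2) * exp z"
    using 1 z by (intro mult_left_mono) auto
  finally have "1 / exp z \<le> 1 - z + z\<^sup>2" by (simp add: divide_le_eq)
  then show ?thesis by (simp add: z_def exp_minus inverse_eq_divide)
qed

text \<open>With w drawn uniformly from \<open>C xs\<close>, every \<open>Y i\<close> is a supermartingale with
  bounded steps, and Azuma's inequality with a union bound over i keeps all of them below B. Taking in
  each step a w for which the sum of the exponentials of \<open>lam * Y i\<close> is at most its average
  has the same effect without a probability space.\<close>
lemma derandomise:
  fixes Y :: "'i \<Rightarrow> 'b list \<Rightarrow> real" and C :: "'b list \<Rightarrow> 'b set" and lam c B :: real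
  assumes I: "finite I" and lam: "0 < lam" "lam * c \<le> 1" "0 \<le> c"
    and step: "\<And>xs. ok xs \<Longrightarrow> length xs < m \<Longrightarrow> (\<forall>i\<in>I. Y i xs \<le> B) \<Longrightarrow>
      finite (C xs) \<and> C xs \<noteq> {} \<and> (\<forall>w\<in>C xs. ok (xs @ [w])) \<and>
      (\<forall>i\<in>I. (\<Sum>w\<in>C xs. Y i (xs @ [w]) - Y i xs) \<le> 0 \<and> (\<forall>w\<in>C xs. \<bar>Y i (xs @ [w]) - Y i xs\<bar> \<le> c))"
    and start: "ok xs0" "\<forall>i\<in>I. Y i xs0 \<le> 0" "length xs0 \<le> m"
    and big: "card I * exp (lam\<^sup>2 * c\<^sup>2 * (m - length xs0)) \<le> exp (lam * B)"
  shows "\<exists>xs. ok xs \<and> length xs = m \<and> (\<forall>i\<in>I. Y i xs \<le> B)"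
proof -
  let ?q = "lam\<^sup>2 * c\<^sup>2"
  let ?Phi = "\<lambda>xs. \<Sum>i\<in>I. exp (lam * Y i xs)"
  have below: "\<forall>i\<in>I. Y i xs \<le> B" if "?Phi xs \<le> card I * exp (?q * t)" "t \<le> real (m - length xs0)" for xs t
  proof
    fix i assume i: "i \<in> I"
    have "exp (lam * Y i xs) \<le> ?Phi xs" using I i by (intro member_le_sum) auto
    also note that(1)
    also have "card I * exp (?q * t) \<le> card I * exp (?q * (m - length xs0))"
      using that(2) start(3) by (intro mult_left_mono) (auto intro!: mult_left_mono)
    also note big
    finally show "Y i xs \<le> B" using lam by simp
  qed
  have "\<exists>xs. ok xs \<and> length xs = length xs0 + t \<and> ?Phi xs \<le> card I * exp (?q * t)"
    if "length xs0 + t \<le> m" for t :: nat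
    using that
  proof (induction t)
    case 0
    have "?Phi xs0 \<le> (\<Sum>i\<in>I. 1)" using start lam by (intro sum_mono) (auto simp: mult_nonneg_nonpos)
    then show ?case using start by (intro exI[of _ xs0]) auto
  next
    case (Suc t)
    then obtain xs where xs: "ok xs" "length xs = length xs0 + t" "?Phi xs \<le> card I * exp (?q * t)" by auto
    have tm: "real t \<le> real (m - length xs0)" using Suc.prems by linarith
    note st = step[OF xs(1) _ below[OF xs(3) tm]]
    have C: "finite (C xs)" "C xs \<noteq> {}" "\<And>w. w \<in> C xs \<Longrightarrow> ok (xs @ [w])"
      "\<And>i. i \<in> I \<Longrightarrow> (\<Sum>w\<in>C xs. Y i (xs @ [w]) - Y i xs) \<le> 0"
      "\<And>i w. i \<in> I \<Longrightarrow> w \<in> C xs \<Longrightarrow> \<bar>Y i (xs @ [w]) - Y i xs\<bar> \<le> c"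
      using st Suc.prems xs(2) by auto
    have avg: "(\<Sum>w\<in>C xs. exp (lam * Y i (xs @ [w]))) \<le> card (C xs) * (exp (lam * Y i xs) * exp ?q)"
      if i: "i \<in> I" for i
    proof -
      let ?d = "\<lambda>w. Y i (xs @ [w]) - Y i xs"
      have "(\<Sum>w\<in>C xs. exp (lam * ?d w)) \<le> (\<Sum>w\<in>C xs. 1 + lam * ?d w + ?q)"
      proof (rule sum_mono)
        fix w assume w: "w \<in> C xs"
        have "\<bar>lam * ?d w\<bar> \<le> lam * c" using C(5)[OF i w] lam by (simp add: abs_mult)
        then have "\<bar>lam * ?d w\<bar> \<le> 1" and "(lam * ?d w)\<^sup>2 \<le> (lam * c)\<^sup>2"
          using lam by (linarith, metis abs_le_square_iff abs_of_nonneg abs_ge_zero order_trans)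
        then show "exp (lam * ?d w) \<le> 1 + lam * ?d w + ?q"
          using exp_le_quadratic[of "lam * ?d w"] by (simp add: power_mult_distrib)
      qed
      also have "\<dots> = card (C xs) * (1 + ?q) + lam * (\<Sum>w\<in>C xs. ?d w)"
        by (simp add: sum.distrib sum_distrib_left sum_subtractf algebra_simps)
      also have "\<dots> \<le> card (C xs) * (1 + ?q)" using C(4)[OF i] lam by (simp add: mult_nonneg_nonpos)
      also have "\<dots> \<le> card (C xs) * exp ?q" by (intro mult_left_mono) (auto simp: exp_ge_add_one_self)
      finally have "exp (lam * Y i xs) * (\<Sum>w\<in>C xs. exp (lam * ?d w)) \<le> exp (lam * Y i xs) * (card (C xs) * exp ?q)"
        by (intro mult_left_mono) auto
      then show ?thesis by (simp add: sum_distrib_left mult_exp_exp algebra_simps)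
    qed
    have "\<exists>w\<in>C xs. ?Phi (xs @ [w]) \<le> ?Phi xs * exp ?q"
    proof (rule ccontr)
      assume "\<not> ?thesis"
      then have "(\<Sum>w\<in>C xs. ?Phi xs * exp ?q) < (\<Sum>w\<in>C xs. ?Phi (xs @ [w]))"
        using C(1,2) by (intro sum_strict_mono) auto
      also have "\<dots> = (\<Sum>i\<in>I. \<Sum>w\<in>C xs. exp (lam * Y i (xs @ [w])))" by (rule sum.swap)
      also have "\<dots> \<le> (\<Sum>i\<in>I. card (C xs) * (exp (lam * Y i xs) * exp ?q))" by (intro sum_mono avg)
      also have "\<dots> = (\<Sum>w\<in>C xs. ?Phi xs * exp ?q)" by (simp add: sum_distrib_left sum_distrib_right)
      finally show False by simp
    qed
    then obtain w where w: "w \<in> C xs" "?Phi (xs @ [w]) \<le> ?Phi xs * exp ?q" by blast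
    have "?Phi xs * exp ?q \<le> card I * exp (?q * t) * exp ?q" using xs(3) by (intro mult_right_mono) auto
    also have "\<dots> = card I * exp (?q * Suc t)" by (simp add: exp_add algebra_simps)
    finally show ?case using w C(3) xs(2) by (intro exI[of _ "xs @ [w]"]) auto
  qed
  from this[of "m - length xs0"] start(3)
  obtain xs where "ok xs" "length xs = m" "?Phi xs \<le> card I * exp (?q * real (m - length xs0))" by auto
  then show ?thesis using below[of xs "m - length xs0"] by auto
qed

section \<open>The labelling game\<close>
lemma power_diff_bounds:
  fixes a b :: real assumes "0 \<le> a" "a \<le> b" "j \<ge> 1"
  shows "j * (b - a) * a ^ (j - 1) \<le> b ^ j - a ^ j" "b ^ j - a ^ j \<le> j * (b - a) * b ^ (j - 1)"
proof -
  have "j * (b - a) * a ^ (j - 1) \<le> b ^ j - a ^ j \<and> b ^ j - a ^ j \<le> j * (b - a) * b ^ (j - 1)"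
    using assms(3)
  proof (induction j rule: dec_induct)
    case base then show ?case by simp
  next
    case (step j)
    have e: "b ^ Suc j - a ^ Suc j = b * (b ^ j - a ^ j) + (b - a) * a ^ j"
      by (simp add: algebra_simps)
    have ja: "a * a ^ (j - 1) = a ^ j" "b * b ^ (j - 1) = b ^ j" using step(1)
      by (metis One_nat_def Suc_pred' le_eq_less_or_eq less_le_trans power_Suc zero_less_one)+
    have l: "a * (j * (b - a) * a ^ (j - 1)) \<le> b * (b ^ j - a ^ j)"
      using step assms(1,2) by (intro mult_mono) auto
    have l': "a * (j * (b - a) * a ^ (j - 1)) = j * (b - a) * a ^ j"
      unfolding ja(1)[symmetric] by (simp add: mult_ac)
    have u: "b * (b ^ j - a ^ j) \<le> b * (j * (b - a) * b ^ (j - 1))"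
      using step assms(1,2) by (intro mult_left_mono) auto
    have u': "b * (j * (b - a) * b ^ (j - 1)) = j * (b - a) * b ^ j"
      unfolding ja(2)[symmetric] by (simp add: mult_ac)
    have "(b - a) * a ^ j \<le> (b - a) * b ^ j" using assms by (intro mult_left_mono power_mono) auto
    with l l' u u' e show ?case by (simp add: algebra_simps)
  qed
  then show "j * (b - a) * a ^ (j - 1) \<le> b ^ j - a ^ j" "b ^ j - a ^ j \<le> j * (b - a) * b ^ (j - 1)" by auto
qed

text \<open>Such a subset is the set of entries of a list of length J, padded by repetition.\<close>
lemma card_small_subsets:
  assumes "finite A"
  shows "finite {F. F \<subseteq> A \<and> F \<noteq> {} \<and> card F \<le> J}" "card {F. F \<subseteq> A \<and> F \<noteq> {} \<and> card F \<le> J} \<le> card A ^ J"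
proof -
  let ?S = "{F. F \<subseteq> A \<and> F \<noteq> {} \<and> card F \<le> J}" and ?T = "{xs. set xs \<subseteq> A \<and> length xs = J}"
  show "finite ?S" using assms by (auto intro: finite_subset[of _ "Pow A"])
  have "?S \<subseteq> set ` ?T"
  proof
    fix F assume F: "F \<in> ?S"
    then have "finite F" using assms finite_subset by auto
    then obtain ys where ys: "set ys = F" "length ys = card F"
      using finite_distinct_list[of F] distinct_card by metis
    obtain a where a: "a \<in> F" using F by auto
    have "F = set (ys @ replicate (J - card F) a)" using ys a by auto
    moreover have "ys @ replicate (J - card F) a \<in> ?T" using F ys a by auto
    ultimately show "F \<in> set ` ?T" by blast
  qed
  then have "card ?S \<le> card (set ` ?T)"
    by (rule card_mono[rotated]) (simp add: finite_lists_length_eq assms)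
  also have "\<dots> \<le> card ?T" by (rule card_image_le) (simp add: finite_lists_length_eq assms)
  finally show "card ?S \<le> card A ^ J" by (simp add: card_lists_length_eq assms)
qed

text \<open>Only the order of the vertices matters: vertex i is labelled in step i, next to the label of its
  parent. The last assumption keeps the densities of unused differences and unused labels at least
  \<open>2 * g\<close> and 1/2 until all n vertices are labelled.\<close>
locale labelling_game = residues_mod N for N +
  fixes n :: nat and par :: "nat \<Rightarrow> nat" and \<Delta> :: nat and g :: real
  assumes par: "1 \<le> i \<Longrightarrow> i < n \<Longrightarrow> par i < i"
    and few_children: "card {i \<in> {1..<n}. par i = k} \<le> \<Delta>"
    and g: "0 < g" "g \<le> 1"
    and room: "2 * g * N \<le> real N - 2 * real n"
begin

definition start_diffs :: "int set" where "start_diffs = {u \<in> Z. (2 * u) mod int N \<noteq> 0}"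
definition free_diffs :: "int list \<Rightarrow> int set" where
  "free_diffs xs = start_diffs - (\<Union>i\<in>{1..<length xs}. {(xs ! i - xs ! par i) mod int N, (xs ! par i - xs ! i) mod int N})"
definition free_labels :: "int list \<Rightarrow> int set" where "free_labels xs = Z - set xs"
abbreviation next_avail :: "int list \<Rightarrow> int set" where
  "next_avail xs \<equiv> avail (free_diffs xs) (free_labels xs) (xs ! par (length xs))"

inductive valid :: "int list \<Rightarrow> bool" where
  valid_start: "valid [0]"
| valid_snoc: "valid xs \<Longrightarrow> length xs < n \<Longrightarrow> w \<in> next_avail xs \<Longrightarrow> valid (xs @ [w])"

lemma free_labels_snoc: "free_labels (xs @ [w]) = free_labels xs - {w}" by (auto simp: free_labels_def)

lemma free_diffs_snoc:
  assumes "1 \<le> length xs" "length xs < n"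
  shows "free_diffs (xs @ [w]) = drop_diffs (free_diffs xs) (xs ! par (length xs)) w"
proof -
  let ?f = "\<lambda>xs i. {(xs ! i - xs ! par i) mod int N, (xs ! par i - xs ! i) mod int N}"
  have pl: "par (length xs) < length xs" using par assms by blast
  have "?f (xs @ [w]) i = ?f xs i" if "i \<in> {1..<length xs}" for i
    using that par[of i] assms by (simp add: nth_append)
  then have "(\<Union>i\<in>{1..<length xs}. ?f (xs @ [w]) i) = (\<Union>i\<in>{1..<length xs}. ?f xs i)" by simp
  moreover have "{1..<length (xs @ [w])} = insert (length xs) {1..<length xs}" using assms by auto
  moreover have "?f (xs @ [w]) (length xs) = {(w - xs ! par (length xs)) mod int N, (xs ! par (length xs) - w) mod int N}"
    using pl by (simp add: nth_append)
  ultimately show ?thesis unfolding free_diffs_def drop_diffs_def by auto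
qed

lemma n_lt_N: "2 * n < N"
proof -
  have "0 < 2 * g * N" using g N_pos by simp
  then have "real (2 * n) < real N" using room by simp
  then show ?thesis using of_nat_less_iff by blast
qed

lemma proper_start_diffs: "proper start_diffs (Z - {0})"
proof -
  have "(2 * ((- u) mod int N)) mod int N \<noteq> 0" if u: "(2 * u) mod int N \<noteq> 0" for u
  proof
    assume "(2 * ((- u) mod int N)) mod int N = 0"
    then have "(- (2 * u)) mod int N = 0" by (simp add: mod_simps)
    then show False using u by (simp add: mod_eq_0_iff_dvd)
  qed
  then show ?thesis by (auto simp: proper_def start_diffs_def)
qed

lemma card_start_diffs: "real N - 2 \<le> card start_diffs"
proof -
  have "Z = start_diffs \<union> {x \<in> Z. int N dvd 2 * x - 0}" by (auto simp: start_diffs_def)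
  then have "card Z \<le> card start_diffs + card {x \<in> Z. int N dvd 2 * x - 0}"
    by (metis card_Un_le)
  then show ?thesis using card_double_le_2[of 0] by simp
qed

lemma valid_facts:
  assumes "valid xs"
  shows "1 \<le> length xs \<and> (length xs \<le> n \<or> length xs = 1) \<and> set xs \<subseteq> Z \<and> distinct xs \<and> proper (free_diffs xs) (free_labels xs)
    \<and> density (free_diffs xs) = density start_diffs - 2 * (real (length xs) - 1) / N \<and> density (free_labels xs) = 1 - length xs / N"
  using assms
proof induction
  case valid_start
  have "card (Z - {0}) = N - 1" using N_pos by (subst card_Diff_singleton) auto
  then have "density (Z - {0}) = 1 - 1 / N" using N_pos by (simp add: density_def of_nat_diff diff_divide_distrib)
  then show ?case using proper_start_diffs N_pos by (simp add: free_diffs_def free_labels_def)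
next
  case (valid_snoc xs w)
  then have pr: "proper (free_diffs xs) (free_labels xs)" and len: "1 \<le> length xs" by auto
  note sd = step_density[OF pr valid_snoc(3)]
  have w: "w \<in> free_labels xs" using valid_snoc(3) by (auto simp: avail_def)
  show ?case unfolding free_diffs_snoc[OF len valid_snoc(2)] free_labels_snoc
    using sd(1-3) valid_snoc w by (auto simp: free_labels_def diff_divide_distrib add_divide_distrib algebra_simps)
qed

lemma valid_room:
  assumes "valid xs" "length xs \<le> n"
  shows "g \<le> density (free_diffs xs) * density (free_labels xs)"
proof -
  have N0: "real N > 0" using N_pos by simp
  note vf = valid_facts[OF assms(1)]
  have "2 * g \<le> density (free_diffs xs)"
  proof -
    have "2 * g * N \<le> card start_diffs - 2 * (real (length xs) - 1)"
    proof -
      have "real (length xs) \<le> real n" using assms(2) by simp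
      then show ?thesis using room card_start_diffs by argo
    qed
    then have "2 * g \<le> (card start_diffs - 2 * (real (length xs) - 1)) / N" using N0 by (simp add: field_simps)
    then show ?thesis using vf by (simp add: density_def diff_divide_distrib)
  qed
  moreover have "1 / 2 \<le> density (free_labels xs)"
  proof -
    have "length xs / N \<le> 1 / 2" using assms(2) n_lt_N N0 by (simp add: field_simps)
    then show ?thesis using vf by simp
  qed
  ultimately have "(2 * g) * (1 / 2) \<le> density (free_diffs xs) * density (free_labels xs)" using g by (intro mult_mono) auto
  then show ?thesis by simp
qed

lemma valid_rainbow:
  assumes "valid xs"
  shows "(\<forall>i\<in>{1..<length xs}. (xs ! i - xs ! par i) mod int N \<in> start_diffs) \<and>
    (\<forall>j\<in>{1..<length xs}. \<forall>i\<in>{1..<j}. (xs ! j - xs ! par j) mod int N \<noteq> (xs ! i - xs ! par i) mod int N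
      \<and> (xs ! j - xs ! par j) mod int N \<noteq> (xs ! par i - xs ! i) mod int N)"
  using assms
proof induction
  case valid_start then show ?case by simp
next
  case (valid_snoc xs w)
  have len: "1 \<le> length xs" using valid_facts[OF valid_snoc(1)] by simp
  have pl: "par (length xs) < length xs" using par len valid_snoc by blast
  have nth: "(xs @ [w]) ! i = xs ! i \<and> (xs @ [w]) ! par i = xs ! par i" if "i \<in> {1..<length xs}" for i
    using that par[of i] valid_snoc by (simp add: nth_append)
  have nl: "(xs @ [w]) ! length xs = w \<and> (xs @ [w]) ! par (length xs) = xs ! par (length xs)"
    using pl by (simp add: nth_append)
  have wU: "(w - xs ! par (length xs)) mod int N \<in> free_diffs xs" using valid_snoc by (auto simp: avail_def)
  have dom: "{1..<length (xs @ [w])} = insert (length xs) {1..<length xs}" using len by auto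
  show ?case unfolding dom
  proof (intro conjI ballI)
    fix i assume "i \<in> insert (length xs) {1..<length xs}"
    then show "((xs @ [w]) ! i - (xs @ [w]) ! par i) mod int N \<in> start_diffs"
      using nth[of i] nl wU valid_snoc.IH by (auto simp: free_diffs_def)
  next
    fix j i assume j: "j \<in> insert (length xs) {1..<length xs}" and i: "i \<in> {1..<j}"
    then have i': "i \<in> {1..<length xs}" by auto
    show "((xs @ [w]) ! j - (xs @ [w]) ! par j) mod int N \<noteq> ((xs @ [w]) ! i - (xs @ [w]) ! par i) mod int N"
      "((xs @ [w]) ! j - (xs @ [w]) ! par j) mod int N \<noteq> ((xs @ [w]) ! par i - (xs @ [w]) ! i) mod int N"
      using nth[of i] nth[of j] nl i i' j wU valid_snoc.IH by (auto simp: free_diffs_def)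
  qed
qed

text \<open>A single parameter bounds the size of the patterns and gives the accuracy; it drops to a quarter in
  each stage.\<close>
definition quasirandom :: "nat \<Rightarrow> int list \<Rightarrow> bool" where
  "quasirandom J xs \<longleftrightarrow> (\<forall>F\<subseteq>forms. F \<noteq> {} \<longrightarrow> card F \<le> J \<longrightarrow> \<bar>deviation (free_diffs xs) (free_labels xs) F\<bar> \<le> N / 2 ^ J)"

definition degenerate_steps :: "form set \<Rightarrow> int list \<Rightarrow> nat" where
  "degenerate_steps F xs = card {i \<in> {1..<length xs}. \<not> clean F (xs ! par i)}"

lemma degenerate_steps_snoc:
  assumes "1 \<le> length xs" "length xs < n"
  shows "degenerate_steps F (xs @ [w]) = degenerate_steps F xs + (if clean F (xs ! par (length xs)) then 0 else 1)"
proof -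
  have "{i \<in> {1..<length (xs @ [w])}. \<not> clean F ((xs @ [w]) ! par i)}
    = {i \<in> {1..<length xs}. \<not> clean F (xs ! par i)} \<union> (if clean F (xs ! par (length xs)) then {} else {length xs})"
    (is "?A = ?B \<union> ?C")
  proof -
    have "par i < length xs" if "1 \<le> i" "i \<le> length xs" for i
      using par[of i] that assms by linarith
    then have "(xs @ [w]) ! par i = xs ! par i" if "1 \<le> i" "i \<le> length xs" for i
      using that by (simp add: nth_append)
    then have "?A = {i \<in> {1..length xs}. \<not> clean F (xs ! par i)}" by (auto simp: less_Suc_eq_le)
    also have "{1..length xs} = insert (length xs) {1..<length xs}" using assms by auto
    finally show ?thesis by auto
  qed
  then show ?thesis unfolding degenerate_steps_def by simp
qed

text \<open>There are few unclean labels, and as labels are distinct each of them is the label of one vertex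
  and hence of the parent in at most \<Delta> steps.\<close>
lemma degenerate_steps_le:
  assumes "F \<subseteq> forms" "valid xs" "length xs \<le> n"
  shows "degenerate_steps F xs \<le> (card F)\<^sup>2 * \<Delta>"
proof -
  note vf = valid_facts[OF assms(2)]
  define K where "K = {k. k < length xs \<and> \<not> clean F (xs ! k)}"
  have "card K = card ((!) xs ` K)" using vf
    by (intro card_image[symmetric]) (auto simp: K_def inj_on_def nth_eq_iff_index_eq)
  also have "\<dots> \<le> card {p \<in> Z. \<not> clean F p}"
    using vf by (intro card_mono finite_subset[of "{p \<in> Z. \<not> clean F p}" Z]) (auto simp: K_def subset_iff)
  also have "\<dots> \<le> (card F)\<^sup>2" by (rule card_unclean[OF assms(1)])
  finally have K: "card K \<le> (card F)\<^sup>2" .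
  have fK: "finite K" by (simp add: K_def)
  have "{i \<in> {1..<length xs}. \<not> clean F (xs ! par i)} \<subseteq> (\<Union>k\<in>K. {i \<in> {1..<n}. par i = k})"
  proof
    fix i assume i: "i \<in> {i \<in> {1..<length xs}. \<not> clean F (xs ! par i)}"
    then have "par i < i" using assms(3) by (intro par) auto
    then have "par i \<in> K" using i by (auto simp: K_def)
    then show "i \<in> (\<Union>k\<in>K. {i \<in> {1..<n}. par i = k})" using i assms(3) by auto
  qed
  then have "degenerate_steps F xs \<le> card (\<Union>k\<in>K. {i \<in> {1..<n}. par i = k})"
    unfolding degenerate_steps_def by (intro card_mono) (use fK in auto)
  also have "\<dots> \<le> (\<Sum>k\<in>K. card {i \<in> {1..<n}. par i = k})" by (rule card_UN_le[OF fK])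
  also have "\<dots> \<le> (\<Sum>k\<in>K. \<Delta>)" by (intro sum_mono few_children)
  also have "\<dots> \<le> (card F)\<^sup>2 * \<Delta>" using K by simp
  finally show ?thesis .
qed

end

context labelling_game begin

lemma abs_deviation_le_N: assumes "valid xs" shows "\<bar>deviation (free_diffs xs) (free_labels xs) F\<bar> \<le> N"
proof -
  have "free_diffs xs \<subseteq> Z" "free_labels xs \<subseteq> Z" using valid_facts[OF assms] by (auto simp: proper_def)
  then have n: "0 \<le> expected (free_diffs xs) (free_labels xs) F" "expected (free_diffs xs) (free_labels xs) F \<le> 1" using expected_bounds by auto
  have "N * expected (free_diffs xs) (free_labels xs) F \<le> real N * 1" using n by (intro mult_left_mono) auto
  moreover have "0 \<le> N * expected (free_diffs xs) (free_labels xs) F" using n by simp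
  moreover have "real (card (solutions (free_diffs xs) (free_labels xs) F)) \<le> N" using card_solutions_le by simp
  ultimately show ?thesis unfolding deviation_def by linarith
qed

text \<open>By the drift lemma, the deviations of patterns of size j grow at a rate proportional to j times those
  of size j + 1. This hierarchy does not close, but at size J the deviation is trivially at most N. With
  the allowance \<open>N * err j t\<close>, where \<open>err j t = r t ^ j / 2 ^ J\<close> and r grows linearly from 2 to 4, the
  allowance at size J is at least N, its growth at size j dominates the drift, and at the end it is still tiny for sizes up to J / 4.
  The growth of r is limited by the rate in the drift lemma, which is why a stage lasts only a constant
  fraction of N steps.\<close>
lemma stage:
  fixes lam c :: real
  assumes xs0: "valid xs0" "quasirandom J xs0" "length xs0 \<le> m" "m \<le> n" "real (m - length xs0) \<le> g * N / 160"
    and J: "64 \<le> g * 2 ^ J"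
    and N1: "3 * real J ^ 2 * 2 ^ J \<le> N" and D1: "4 * real J ^ 3 * \<Delta> \<le> N / 2 ^ (J + 1)"
    and lam: "0 < lam" "lam * c \<le> 1" and c: "6 * real J + 320 * real J * 4 ^ J / g \<le> c"
    and big: "2 * (3 * real N) ^ J * exp (lam\<^sup>2 * c\<^sup>2 * N) \<le> exp (lam * (N / 2 ^ (J + 1)))"
  shows "\<exists>xs. valid xs \<and> length xs = m \<and> quasirandom (J div 4) xs"
proof -
  have N0: "real N > 0" using N_pos by simp
  have N1': "real N \<ge> 1" using N_pos by simp
  have J64: "(64::real) \<le> 2 ^ J"
  proof -
    have "g * 2 ^ J \<le> 1 * 2 ^ J" using g by (intro mult_right_mono) auto
    then show ?thesis using J by linarith
  qed
  have J6: "6 \<le> J"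
  proof (rule ccontr)
    assume "\<not> 6 \<le> J"
    then have "(2::real) ^ J \<le> 2 ^ 5" by (intro power_increasing) auto
    then show False using J64 by simp
  qed
  define k where "k = length xs0"
  define \<kappa> where "\<kappa> = 320 / (g * N)"
  define r where "r t = 2 + \<kappa> * real t" for t :: nat
  define err where "err j t = r t ^ j / 2 ^ J" for j t :: nat
  have kap: "\<kappa> > 0" using g N0 by (simp add: \<kappa>_def)
  have kk: "1 \<le> k" using valid_facts[OF xs0(1)] by (simp add: k_def)
  have r2: "2 \<le> r t" for t using kap by (simp add: r_def)
  have r4: "r t \<le> 4" if "t \<le> m - k" for t
  proof -
    have "real t \<le> g * N / 160" using that xs0(5) unfolding k_def by linarith
    then have "\<kappa> * t \<le> \<kappa> * (g * N / 160)" using kap by (intro mult_left_mono) auto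
    also have "\<dots> = 2" using g N0 by (simp add: \<kappa>_def)
    finally show ?thesis by (simp add: r_def)
  qed
  have rS: "r (Suc t) - r t = \<kappa>" for t by (simp add: r_def algebra_simps)
  have err_ge: "1 / 2 ^ J \<le> err j t" for j t
    using one_le_power[of "r t" j] r2[of t] unfolding err_def by (intro divide_right_mono) auto
  have err0: "0 \<le> err j t" for j t using r2[of t] by (simp add: err_def)
  have err_mono: "err j t \<le> err j' t" if "j \<le> j'" for j j' t
    unfolding err_def using that r2[of t] by (intro divide_right_mono power_increasing) auto
  \<comment> \<open>The allowance for size j grows at least as fast as the drift caused by size j + 1.\<close>
  have inc_lo: "20 * real j * err (j + 1) t / g \<le> N * (err j (Suc t) - err j t)"
    if "1 \<le> j" "t \<le> m - k" for j t
  proof -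
    have "r t ^ (j + 1) = r t ^ (j - 1) * (r t)\<^sup>2" using that(1)
      by (cases j) (simp_all add: power2_eq_square mult_ac)
    also have "\<dots> \<le> r t ^ (j - 1) * 4\<^sup>2" using r2[of t] r4[OF that(2)] by (intro mult_left_mono power_mono) auto
    finally have 1: "r t ^ (j + 1) \<le> 16 * r t ^ (j - 1)" by simp
    have "20 * real j * err (j + 1) t / g = 20 * real j / (g * 2 ^ J) * r t ^ (j + 1)" by (simp add: err_def)
    also have "\<dots> \<le> 20 * real j / (g * 2 ^ J) * (16 * r t ^ (j - 1))" using 1 g by (intro mult_left_mono) auto
    also have "\<dots> = N * (real j * \<kappa> * r t ^ (j - 1) / 2 ^ J)" using N0 g by (simp add: \<kappa>_def field_simps)
    also have "\<dots> \<le> N * ((r (Suc t) ^ j - r t ^ j) / 2 ^ J)"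
      using power_diff_bounds(1)[of "r t" "r (Suc t)" j] r2[of t] kap rS[of t] that(1) N0
      by (intro mult_left_mono divide_right_mono) auto
    also have "\<dots> = N * (err j (Suc t) - err j t)" by (simp add: err_def diff_divide_distrib)
    finally show ?thesis .
  qed
  have inc_hi: "N * (err j (Suc t) - err j t) \<le> 320 * real J * 4 ^ J / g"
    if "1 \<le> j" "j \<le> J" "Suc t \<le> m - k" for j t
  proof -
    have "r (Suc t) ^ (j - 1) \<le> 4 ^ (j - 1)" using r2[of "Suc t"] r4[OF that(3)] by (intro power_mono) auto
    also have "\<dots> \<le> 4 ^ J" using that by (intro power_increasing) auto
    finally have 1: "r (Suc t) ^ (j - 1) \<le> 4 ^ J" .
    have "r (Suc t) ^ j - r t ^ j \<le> real j * \<kappa> * r (Suc t) ^ (j - 1)"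
      using power_diff_bounds(2)[of "r t" "r (Suc t)" j] r2[of t] kap rS[of t] that(1) by auto
    also have "\<dots> \<le> real J * \<kappa> * 4 ^ J" using 1 that kap r2[of "Suc t"] by (intro mult_mono) auto
    finally have 2: "r (Suc t) ^ j - r t ^ j \<le> real J * \<kappa> * 4 ^ J" .
    have "err j (Suc t) - err j t = (r (Suc t) ^ j - r t ^ j) / 2 ^ J" by (simp add: err_def diff_divide_distrib)
    also have "\<dots> \<le> (real J * \<kappa> * 4 ^ J) / 1" using 2 kap J64 by (intro frac_le) auto
    finally have "N * (err j (Suc t) - err j t) \<le> N * (real J * \<kappa> * 4 ^ J)" using N0 by simp
    also have "\<dots> = 320 * real J * 4 ^ J / g" using N0 g by (simp add: \<kappa>_def)
    finally show ?thesis .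
  qed
  define S where "S = {F. F \<subseteq> forms \<and> F \<noteq> {} \<and> card F \<le> J - 1}"
  define I where "I = S \<times> {1, -1 :: real}"
  \<comment> \<open>A signed deviation minus its allowance; a degenerate step is charged 4 * J, more than any step can change a deviation.\<close>
  define Y where "Y i xs = snd i * deviation (free_diffs xs) (free_labels xs) (fst i) - N * err (card (fst i)) (length xs - k)
      - 4 * real J * degenerate_steps (fst i) xs" for i xs
  define B where "B = N / 2 ^ (J + 1)"
  have cardF: "1 \<le> card F" "finite F" if "F \<subseteq> forms" "F \<noteq> {}" for F
    using that finite_forms finite_subset by (auto simp: Suc_le_eq card_gt_0_iff)
  have finI: "finite I" unfolding I_def S_def using card_small_subsets(1)[OF finite_forms] by simp
  have cardI: "card I \<le> 2 * (3 * real N) ^ J"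
  proof -
    have "card S \<le> card forms ^ (J - 1)" unfolding S_def by (rule card_small_subsets(2)[OF finite_forms])
    also have "\<dots> \<le> (3 * N) ^ (J - 1)" by (rule power_mono[OF card_forms]) simp
    also have "\<dots> \<le> (3 * N) ^ J" using N_pos by (intro power_increasing) auto
    finally have "real (card S) \<le> real ((3 * N) ^ J)" by (rule of_nat_mono)
    then show ?thesis by (simp add: I_def card_cartesian_product)
  qed
  have degenerate_cost: "4 * real J * degenerate_steps F xs \<le> B" if F: "F \<subseteq> forms" "card F \<le> J" and xs: "valid xs" "length xs \<le> m" for F xs
  proof -
    have "degenerate_steps F xs \<le> (card F)\<^sup>2 * \<Delta>" using xs xs0(4) by (intro degenerate_steps_le F) auto
    also have "\<dots> \<le> J\<^sup>2 * \<Delta>" using F(2) by (intro mult_right_mono power_mono) auto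
    finally have "real (degenerate_steps F xs) \<le> real (J\<^sup>2 * \<Delta>)" by (rule of_nat_mono)
    then have "4 * real J * degenerate_steps F xs \<le> 4 * real J * real (J\<^sup>2 * \<Delta>)" by (intro mult_left_mono) auto
    also have "\<dots> = 4 * real J ^ 3 * \<Delta>" by (simp add: power2_eq_square power3_eq_cube)
    finally show ?thesis using D1 by (simp add: B_def)
  qed
  have tube: "\<bar>deviation (free_diffs xs) (free_labels xs) F\<bar> \<le> 2 * N * err (card F) (length xs - k)"
    if xs: "valid xs" "length xs \<le> m" "\<forall>i\<in>I. Y i xs \<le> B"
      and F: "F \<subseteq> forms" "F \<noteq> {}" "card F \<le> J" for F xs
  proof (cases "card F = J")
    case True
    \<comment> \<open>Patterns of the full size J need no control: their allowance exceeds the trivial bound.\<close>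
    have "1 \<le> err J (length xs - k)"
      unfolding err_def using power_mono[of 2 "r (length xs - k)" J] r2 by simp
    then have "real N * 1 \<le> N * (2 * err J (length xs - k))" by (intro mult_left_mono) auto
    then show ?thesis using abs_deviation_le_N[OF xs(1), of F] True by simp
  next
    case False
    have "2 * B \<le> N * err (card F) (length xs - k)"
      using mult_left_mono[OF err_ge[of "card F" "length xs - k"], of N] by (simp add: B_def)
    moreover have "Y (F, 1) xs \<le> B" "Y (F, -1) xs \<le> B" using xs F False by (auto simp: I_def S_def)
    ultimately show ?thesis using degenerate_cost[OF F(1,3) xs(1,2)] unfolding Y_def by simp
  qed
  have step: "finite (next_avail xs) \<and> next_avail xs \<noteq> {} \<and> (\<forall>w\<in>next_avail xs. valid (xs @ [w]) \<and> k \<le> length (xs @ [w])) \<and>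
      (\<forall>i\<in>I. (\<Sum>w\<in>next_avail xs. Y i (xs @ [w]) - Y i xs) \<le> 0 \<and> (\<forall>w\<in>next_avail xs. \<bar>Y i (xs @ [w]) - Y i xs\<bar> \<le> c))"
    if xs: "valid xs \<and> k \<le> length xs" "length xs < m" "\<forall>i\<in>I. Y i xs \<le> B" for xs
  proof -
    define U L p where "U = free_diffs xs" and "L = free_labels xs" and "p = xs ! par (length xs)"
    define t where "t = length xs - k"
    have tm: "Suc t \<le> m - k" using xs by (auto simp: t_def)
    have len: "1 \<le> length xs" "length xs < n" using kk xs xs0(4) by auto
    have pr: "proper U L" using valid_facts xs by (auto simp: U_def L_def)
    have tb: "\<bar>deviation U L F\<bar> \<le> 2 * N * err (card F) t" if "F \<subseteq> forms" "F \<noteq> {}" "card F \<le> J" for F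
      unfolding U_def L_def t_def using tube[OF _ _ xs(3) that] xs by auto
    have room: "g \<le> density U * density L" unfolding U_def L_def using valid_room xs len by auto
    define F2 where "F2 = {LabelPlus 0, Difference ((- p) mod int N)}"
    have F2: "F2 \<subseteq> forms" "F2 \<noteq> {}" "card F2 = 2"
      unfolding F2_def forms_def using mod_in_Z N_pos by auto
    have dF2: "\<bar>deviation U L F2\<bar> \<le> 2 * N * err 2 t" using tb[OF F2(1,2)] F2(3) J6 by simp
    have many: "N * g / 2 \<le> card (avail U L p)"
    proof -
      have "err 2 t \<le> 4\<^sup>2 / 2 ^ J" unfolding err_def using r2[of t] r4[of t] tm
        by (intro divide_right_mono power_mono) auto
      also have "\<dots> \<le> g / 4" using J by (simp add: field_simps)
      finally have "2 * N * err 2 t \<le> 2 * N * (g / 4)" by (intro mult_left_mono) auto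
      also have "\<dots> = N * g / 2" by simp
      finally have "2 * N * err 2 t \<le> N * g / 2" .
      moreover have "N * g \<le> N * (density U * density L)" using room by (intro mult_left_mono) auto
      ultimately show ?thesis using dF2 card_avail_deviation[OF pr, of p] unfolding F2_def[symmetric] by argo
    qed
    have ne: "avail U L p \<noteq> {}"
    proof
      assume "avail U L p = {}"
      moreover have "0 < N * g / 2" using N0 g by simp
      ultimately show False using many by simp
    qed
    have snoc: "free_diffs (xs @ [w]) = drop_diffs U p w" "free_labels (xs @ [w]) = L - {w}" for w
      unfolding U_def L_def p_def by (rule free_diffs_snoc[OF len], rule free_labels_snoc)
    have St: "length (xs @ [w]) - k = Suc t" for w using xs by (simp add: t_def Suc_diff_le)
    have Ydiff: "Y (F, s) (xs @ [w]) - Y (F, s) xs = s * (deviation (drop_diffs U p w) (L - {w}) F - deviation U L F)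
        - N * (err (card F) (Suc t) - err (card F) t) - (if clean F p then 0 else 4 * real J)" for F s w
      unfolding Y_def fst_conv snd_conv snoc St degenerate_steps_snoc[OF len] t_def[symmetric] U_def[symmetric] L_def[symmetric]
        p_def[symmetric] by (simp add: algebra_simps)
    have both: "(\<Sum>w\<in>avail U L p. Y (F, s) (xs @ [w]) - Y (F, s) xs) \<le> 0 \<and>
        (\<forall>w\<in>avail U L p. \<bar>Y (F, s) (xs @ [w]) - Y (F, s) xs\<bar> \<le> c)"
      if "(F, s) \<in> I" for F s
    proof -
      define j where "j = card F"
      have F: "F \<subseteq> forms" "F \<noteq> {}" "j \<le> J - 1" and s: "\<bar>s\<bar> = 1"
        using that by (auto simp: I_def S_def j_def)
      note cF = cardF[OF F(1,2), folded j_def]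
      have jJ: "j + 1 \<le> J" using F(3) J6 by simp
      define inc where "inc = N * (err j (Suc t) - err j t)"
      have inc0: "20 * real j * err (j + 1) t / g \<le> inc" unfolding inc_def using cF tm by (intro inc_lo) auto
      have inc00: "0 \<le> 20 * real j * err (j + 1) t / g" using err0[of "j + 1" t] g by simp
      have inc1: "inc \<le> 320 * real J * 4 ^ J / g" unfolding inc_def using cF tm jJ by (intro inc_hi) auto
      have dd: "\<bar>s * (deviation (drop_diffs U p w) (L - {w}) F - deviation U L F)\<bar> \<le> 2 * real j" if "w \<in> avail U L p" for w
        using deviation_step_bound[OF pr that cF(2)] s by (simp add: abs_mult j_def)
      have "\<bar>Y (F, s) (xs @ [w]) - Y (F, s) xs\<bar> \<le> c" if "w \<in> avail U L p" for w
        using dd[OF that] inc0 inc00 inc1 c jJ unfolding Ydiff j_def[symmetric] inc_def[symmetric] by (auto split: if_splits)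
      moreover have "(\<Sum>w\<in>avail U L p. Y (F, s) (xs @ [w]) - Y (F, s) xs) \<le> 0"
      proof (cases "clean F p")
        case False
        show ?thesis
        proof (rule sum_nonpos)
          fix w assume "w \<in> avail U L p"
          from dd[OF this] show "Y (F, s) (xs @ [w]) - Y (F, s) xs \<le> 0"
            using inc0 inc00 jJ False unfolding Ydiff j_def[symmetric] inc_def[symmetric] by auto
        qed
      next
        case True
        define cnt where "cnt = real (card (avail U L p))"
        define eps where "eps = 2 * err (j + 1) t"
        have eps0: "0 \<le> eps" using err0 by (simp add: eps_def)
        have dext: "\<bar>deviation U L (insert e F)\<bar> \<le> eps * N" if "f \<in> F" "e \<in> companions p f" for f e
        proof -
          have "e \<notin> F" using True that by (auto simp: clean_def)
          then have cj: "card (insert e F) = j + 1" using cF(2) by (simp add: j_def)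
          have "insert e F \<subseteq> forms" using that companions_subset_forms F(1) by blast
          then have "\<bar>deviation U L (insert e F)\<bar> \<le> 2 * N * err (card (insert e F)) t"
            using jJ cj by (intro tb) auto
          then show ?thesis unfolding cj eps_def by (simp add: mult_ac)
        qed
        have "err 2 t \<le> err (j + 1) t" using cF by (intro err_mono) auto
        then have "2 * N * err 2 t \<le> 2 * N * err (j + 1) t" by (intro mult_left_mono) auto
        then have dF2': "\<bar>deviation U L {LabelPlus 0, Difference ((- p) mod int N)}\<bar> \<le> eps * N"
          using dF2 unfolding F2_def eps_def by (simp add: mult_ac)
        have "\<bar>\<Sum>w\<in>avail U L p. deviation (drop_diffs U p w) (L - {w}) F - deviation U L F\<bar>
            \<le> cnt * (8 * real j * eps / g + 12 * real j ^ 3 / (g * N))"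
          unfolding cnt_def j_def using clean_drift[OF pr F(1) True F(2) g eps0 dext dF2' many] by simp
        also have "\<dots> \<le> cnt * inc"
        proof (rule mult_left_mono)
          have "3 * real j ^ 2 * 2 ^ J \<le> 3 * real J ^ 2 * 2 ^ J"
            using jJ by (intro mult_right_mono mult_left_mono power_mono) auto
          then have "3 * real j ^ 2 * 2 ^ J \<le> N" using N1 by linarith
          then have "3 * real j ^ 2 / N \<le> 1 / 2 ^ J" using N0 by (simp add: field_simps)
          then have "3 * real j ^ 2 / N \<le> err (j + 1) t" using err_ge order_trans by blast
          then have "4 * real j / g * (3 * real j ^ 2 / N) \<le> 4 * real j / g * err (j + 1) t"
            using g by (intro mult_left_mono) auto
          then have "12 * real j ^ 3 / (g * N) \<le> 4 * real j * err (j + 1) t / g"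
            by (simp add: power2_eq_square power3_eq_cube mult_ac)
          moreover have "8 * real j * eps / g = 16 * real j * err (j + 1) t / g" by (simp add: eps_def)
          moreover have "20 * real j * err (j + 1) t / g = 16 * real j * err (j + 1) t / g + 4 * real j * err (j + 1) t / g"
            by (simp add: add_divide_distrib[symmetric])
          ultimately show "8 * real j * eps / g + 12 * real j ^ 3 / (g * N) \<le> inc" using inc0 by argo
        qed (simp add: cnt_def)
        finally have d: "\<bar>\<Sum>w\<in>avail U L p. deviation (drop_diffs U p w) (L - {w}) F - deviation U L F\<bar> \<le> cnt * inc" .
        have "(\<Sum>w\<in>avail U L p. Y (F, s) (xs @ [w]) - Y (F, s) xs)
          = s * (\<Sum>w\<in>avail U L p. deviation (drop_diffs U p w) (L - {w}) F - deviation U L F) - cnt * inc"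
          unfolding Ydiff j_def[symmetric] inc_def[symmetric] using True
          by (simp add: sum_subtractf sum_distrib_left right_diff_distrib cnt_def)
        also have "\<dots> \<le> 0"
        proof -
          have "\<bar>s * (\<Sum>w\<in>avail U L p. deviation (drop_diffs U p w) (L - {w}) F - deviation U L F)\<bar> \<le> cnt * inc"
            using d s by (simp add: abs_mult)
          then show ?thesis by linarith
        qed
        finally show ?thesis .
      qed
      ultimately show ?thesis by blast
    qed
    have fa: "finite (avail U L p)" using pr by simp
    have vs: "valid (xs @ [w]) \<and> k \<le> length (xs @ [w])" if "w \<in> avail U L p" for w
      using valid_snoc[of xs w] xs(1) len that unfolding U_def L_def p_def by auto
    have "\<forall>i\<in>I. (\<Sum>w\<in>avail U L p. Y i (xs @ [w]) - Y i xs) \<le> 0 \<and> (\<forall>w\<in>avail U L p. \<bar>Y i (xs @ [w]) - Y i xs\<bar> \<le> c)"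
      using both by auto
    with fa ne vs show ?thesis unfolding U_def L_def p_def by blast
  qed
  have c0: "0 \<le> c"
  proof -
    have "0 \<le> 6 * real J + 320 * real J * 4 ^ J / g" using g by simp
    then show ?thesis using c by linarith
  qed
  have start: "\<forall>i\<in>I. Y i xs0 \<le> 0"
  proof
    fix i assume i: "i \<in> I"
    obtain F s where Fs: "i = (F, s)" by (cases i)
    have F: "F \<subseteq> forms" "F \<noteq> {}" "card F \<le> J" and s: "\<bar>s\<bar> = 1" using i J6 by (auto simp: Fs I_def S_def)
    have "\<bar>s * deviation (free_diffs xs0) (free_labels xs0) F\<bar> \<le> N / 2 ^ J" using xs0(2) F s by (simp add: quasirandom_def abs_mult)
    also have "\<dots> \<le> N * err (card F) 0" using mult_left_mono[OF err_ge[of "card F" 0], of N] by simp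
    finally have "s * deviation (free_diffs xs0) (free_labels xs0) F \<le> N * err (card F) 0" by linarith
    moreover have "0 \<le> 4 * real J * degenerate_steps F xs0" by simp
    ultimately show "Y i xs0 \<le> 0" unfolding Y_def Fs k_def fst_conv snd_conv diff_self_eq_0 by linarith
  qed
  have "card I * exp (lam\<^sup>2 * c\<^sup>2 * (m - length xs0)) \<le> exp (lam * B)"
  proof -
    have "m - length xs0 \<le> N" using xs0(4) n_lt_N by linarith
    then have "lam\<^sup>2 * c\<^sup>2 * (m - length xs0) \<le> lam\<^sup>2 * c\<^sup>2 * N" by (intro mult_left_mono) auto
    then have "card I * exp (lam\<^sup>2 * c\<^sup>2 * (m - length xs0)) \<le> 2 * (3 * real N) ^ J * exp (lam\<^sup>2 * c\<^sup>2 * N)"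
      using cardI by (intro mult_mono) auto
    with big show ?thesis by (simp add: B_def)
  qed
  note count = this
  have "\<exists>xs. (valid xs \<and> k \<le> length xs) \<and> length xs = m \<and> (\<forall>i\<in>I. Y i xs \<le> B)"
  proof (rule derandomise[where C = next_avail and lam = lam and c = c and ?xs0.0 = xs0])
    show "valid xs0 \<and> k \<le> length xs0" using xs0(1) by (simp add: k_def)
  qed (use finI lam c0 step start xs0(3) count in blast)+
  then obtain xs where xs: "valid xs" "length xs = m" "\<forall>i\<in>I. Y i xs \<le> B" by blast
  have "quasirandom (J div 4) xs"
    unfolding quasirandom_def
  proof (intro allI impI)
    fix F assume F: "F \<subseteq> forms" "F \<noteq> {}" "card F \<le> J div 4"
    define J' where "J' = J div 4"
    have "\<bar>deviation (free_diffs xs) (free_labels xs) F\<bar> \<le> 2 * N * err (card F) (m - k)"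
      using tube[OF xs(1) _ xs(3) F(1,2)] F(3) xs(2) by auto
    also have "\<dots> \<le> 2 * N * (4 ^ J' / 2 ^ J)"
    proof (intro mult_left_mono)
      have "r (m - k) ^ card F \<le> 4 ^ card F" using r2[of "m - k"] r4[of "m - k"] by (intro power_mono) auto
      also have "\<dots> \<le> 4 ^ J'" using F(3) by (intro power_increasing) (auto simp: J'_def)
      finally show "err (card F) (m - k) \<le> 4 ^ J' / 2 ^ J" unfolding err_def by (intro divide_right_mono) auto
    qed auto
    also have "\<dots> \<le> N / 2 ^ J'"
    proof -
      have "2 * 4 ^ J' * 2 ^ J' = (2::real) ^ (1 + 2 * J' + J')"
        by (simp add: power_add power_mult power_mult_distrib[symmetric])
      also have "\<dots> \<le> 2 ^ J" using J6 by (intro power_increasing) (auto simp: J'_def)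
      finally have "2 * (4 ^ J' / 2 ^ J) \<le> 1 / (2::real) ^ J'" by (simp add: field_simps)
      then have "N * (2 * (4 ^ J' / 2 ^ J)) \<le> N * (1 / (2::real) ^ J')" by (intro mult_left_mono) auto
      then show ?thesis by (simp add: mult_ac)
    qed
    finally show "\<bar>deviation (free_diffs xs) (free_labels xs) F\<bar> \<le> N / 2 ^ (J div 4)" by (simp add: J'_def)
  qed
  with xs show ?thesis by blast
qed

end

section \<open>Running the stages\<close>

context labelling_game begin

text \<open>Before the first step every form fails for at most two x.\<close>
lemma quasirandom_initial:
  assumes "2 * real J * 2 ^ J \<le> N"
  shows "quasirandom J [0]"
  unfolding quasirandom_def
proof (intro allI impI)
  fix F assume F: "F \<subseteq> forms" "F \<noteq> {}" "card F \<le> J"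
  have N0: "real N > 0" using N_pos by simp
  have fin: "finite F" using F finite_forms finite_subset by blast
  define U L where "U = free_diffs [0]" and "L = free_labels [0]"
  have U: "U = start_diffs" and L: "L = Z - {0}" by (auto simp: U_def L_def free_diffs_def free_labels_def)
  have pr: "proper U L" using proper_start_diffs U L by simp
  then have UL: "U \<subseteq> Z" "L \<subseteq> Z" by (auto simp: proper_def)
  have fails: "card {x \<in> Z. \<not> holds U L x f} \<le> 2" for f
  proof -
    obtain k where k: "{x \<in> Z. \<not> holds U L x f} \<subseteq> {x \<in> Z. int N dvd 2 * x - k}"
    proof (cases f)
      case (Difference a)
      have "int N dvd 2 * x - (- 2 * a)" if "(x + a) mod int N \<notin> start_diffs" for x
      proof -
        have "(2 * ((x + a) mod int N)) mod int N = 0" using that mod_in_Z[of "x + a"] unfolding start_diffs_def by blast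
        then have "int N dvd 2 * (x + a)" by (simp add: mod_simps mod_eq_0_iff_dvd)
        then show ?thesis by (simp add: algebra_simps)
      qed
      then show ?thesis using Difference U by (intro that[of "- 2 * a"]) auto
    next
      case (LabelPlus b)
      have "int N dvd 2 * x - (- 2 * b)" if "(x + b) mod int N = 0" for x
        using dvd_mult[of "int N" "x + b" 2] that by (simp add: mod_eq_0_iff_dvd algebra_simps)
      then show ?thesis using LabelPlus L by (intro that[of "- 2 * b"]) auto
    next
      case (LabelMinus b)
      have "int N dvd 2 * x - 2 * b" if "(b - x) mod int N = 0" for x
        using dvd_mult[of "int N" "b - x" "- 2"] that by (simp add: mod_eq_0_iff_dvd algebra_simps)
      then show ?thesis using LabelMinus L by (intro that[of "2 * b"]) auto
    qed
    have "card {x \<in> Z. \<not> holds U L x f} \<le> card {x \<in> Z. int N dvd 2 * x - k}"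
      by (rule card_mono[OF _ k]) (auto intro: finite_subset[of _ Z])
    then show ?thesis using card_double_le_2[of k] by linarith
  qed
  have s: "real N - 2 * card F \<le> card (solutions U L F)"
  proof -
    have "Z = solutions U L F \<union> (\<Union>f\<in>F. {x \<in> Z. \<not> holds U L x f})" by (auto simp: solutions_def)
    then have "N \<le> card (solutions U L F \<union> (\<Union>f\<in>F. {x \<in> Z. \<not> holds U L x f}))"
      by (metis card_atLeastLessThan_int diff_zero nat_int order_refl)
    also have "\<dots> \<le> card (solutions U L F) + card (\<Union>f\<in>F. {x \<in> Z. \<not> holds U L x f})" by (rule card_Un_le)
    also have "card (\<Union>f\<in>F. {x \<in> Z. \<not> holds U L x f}) \<le> (\<Sum>f\<in>F. card {x \<in> Z. \<not> holds U L x f})"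
      by (rule card_UN_le[OF fin])
    also have "\<dots> \<le> (\<Sum>f\<in>F. 2)" by (intro sum_mono fails)
    finally show ?thesis by simp
  qed
  have nm: "real N - 2 * card F \<le> N * expected U L F"
  proof -
    have "real N - 2 \<le> card U" using card_start_diffs U by simp
    then have "(real N - card U) / N \<le> 2 / N" by (intro divide_right_mono) auto
    then have u: "1 - density U \<le> 2 / N" using N0 by (simp add: density_def diff_divide_distrib)
    have "card L = N - 1" unfolding L using N_pos by (subst card_Diff_singleton) auto
    then have "(real N - card L) / N \<le> 2 / N" using N_pos by (intro divide_right_mono) (auto simp: of_nat_diff)
    then have l: "1 - density L \<le> 2 / N" using N0 by (simp add: density_def diff_divide_distrib)
    note b = density_bounds[OF UL(1)] density_bounds[OF UL(2)]
    have w: "0 \<le> 1 - weight (density U) (density L) f \<and> 1 - weight (density U) (density L) f \<le> 1 \<and> (1::real) \<le> 1" for f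
      using b by (cases f) auto
    have "(\<Prod>f\<in>F. 1) - (\<Prod>f\<in>F. 1 - (1 - weight (density U) (density L) f)) \<le> (\<Sum>f\<in>F. 1 - weight (density U) (density L) f)"
      by (rule prod_diff_expand(3)[OF fin w])
    also have "\<dots> \<le> (\<Sum>f\<in>F. 2 / N)"
    proof (rule sum_mono)
      fix f show "1 - weight (density U) (density L) f \<le> 2 / N" using u l by (cases f) auto
    qed
    finally have "1 - expected U L F \<le> 2 * card F / N" by (simp add: expected_def mult.commute)
    then show ?thesis using N0 by (simp add: field_simps)
  qed
  have "real (card (solutions U L F)) \<le> N" using card_solutions_le by simp
  moreover have "N * expected U L F \<le> real N * 1" using expected_bounds(2)[OF UL, of F] by (intro mult_left_mono) auto
  ultimately have "\<bar>deviation U L F\<bar> \<le> 2 * real (card F)" using s nm unfolding deviation_def by linarith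
  also have "\<dots> \<le> 2 * real J" using F(3) by simp
  also have "\<dots> \<le> N / 2 ^ J" using assms by (simp add: field_simps)
  finally show "\<bar>deviation (free_diffs [0]) (free_labels [0]) F\<bar> \<le> N / 2 ^ J" by (simp add: U_def L_def)
qed

end

text \<open>The numerical premises of a stage. The last one says that the exponential moments beat the
  number of patterns, which is polynomial in N.\<close>
definition stage_ready :: "real \<Rightarrow> nat \<Rightarrow> nat \<Rightarrow> nat \<Rightarrow> bool" where
  "stage_ready g J N \<Delta> \<longleftrightarrow> 3 * real J ^ 2 * 2 ^ J \<le> N \<and> 4 * real J ^ 3 * \<Delta> \<le> N / 2 ^ (J + 1) \<and>
     (\<exists>lam c. 0 < lam \<and> lam * c \<le> 1 \<and> 6 * real J + 320 * real J * 4 ^ J / g \<le> c \<and>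
       2 * (3 * real N) ^ J * exp (lam\<^sup>2 * c\<^sup>2 * N) \<le> exp (lam * (N / 2 ^ (J + 1))))"

lemma eventually_poly_le_exp:
  fixes \<theta> :: real assumes "\<theta> > 0"
  shows "\<forall>\<^sub>F N in sequentially. 2 * (3 * real N) ^ J \<le> exp (\<theta> * N)"
proof -
  have "((\<lambda>x. x ^ J / exp x) \<longlongrightarrow> (0::real)) at_top" by (rule tendsto_power_div_exp_0)
  moreover have "filterlim (\<lambda>N. \<theta> * real N) at_top sequentially"
    by (rule filterlim_tendsto_pos_mult_at_top[OF tendsto_const assms filterlim_real_sequentially])
  ultimately have "((\<lambda>N. (\<theta> * real N) ^ J / exp (\<theta> * real N)) \<longlongrightarrow> 0) sequentially"
    by (rule filterlim_compose)
  moreover have "0 < 1 / (2 * (3 / \<theta>) ^ J)" using assms by simp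
  ultimately have "\<forall>\<^sub>F N in sequentially. (\<theta> * real N) ^ J / exp (\<theta> * real N) < 1 / (2 * (3 / \<theta>) ^ J)"
    by (rule order_tendstoD(2))
  then show ?thesis
  proof eventually_elim
    case (elim N)
    have "2 * (3 * real N) ^ J = 2 * (3 / \<theta>) ^ J * (\<theta> * real N) ^ J"
      using assms by (simp add: power_mult_distrib power_divide)
    also have "\<dots> \<le> exp (\<theta> * N)" using elim assms by (simp add: field_simps)
    finally show ?case .
  qed
qed

lemma stage_ready_eventually:
  assumes g: "0 < g"
  shows "\<exists>\<eta>>0. \<exists>N1. \<forall>N\<ge>N1. \<forall>\<Delta>. real \<Delta> \<le> \<eta> * N \<longrightarrow> stage_ready g J N \<Delta>"
proof -
  define d where "d = 1 / (2::real) ^ (J + 1)"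
  define c where "c = 6 * real J + 320 * real J * 4 ^ J / g + 1"
  define lam where "lam = d / (2 * c\<^sup>2)"
  define \<eta> where "\<eta> = d / (4 * real J ^ 3 + 1)"
  have "(1::real) \<le> 2 ^ (J + 1)" by (rule one_le_power) simp
  then have d: "0 < d" "d \<le> 1" by (simp_all add: d_def)
  have c: "1 \<le> c" using g by (simp add: c_def)
  have lam: "0 < lam" using d c by (simp add: lam_def)
  have lamc: "lam * c \<le> 1"
  proof -
    have "lam * c = d / (2 * c)" using c by (simp add: lam_def power2_eq_square)
    also have "\<dots> \<le> 1" using d c by (simp add: divide_le_eq)
    finally show ?thesis .
  qed
  have lam2: "lam\<^sup>2 * c\<^sup>2 = lam * d / 2" using c by (simp add: lam_def power2_eq_square)
  have eta: "0 < \<eta>" using d by (simp add: \<eta>_def add_nonneg_pos)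
  obtain N1 where N1: "\<And>N. N \<ge> N1 \<Longrightarrow> 2 * (3 * real N) ^ J \<le> exp (lam * d / 2 * N)"
    using eventually_poly_le_exp[of "lam * d / 2" J] lam d unfolding eventually_sequentially by auto
  obtain N2 :: nat where N2: "3 * real J ^ 2 * 2 ^ J \<le> N2" using real_arch_simple by blast
  have "stage_ready g J N \<Delta>" if N: "N \<ge> max N1 N2" and few: "real \<Delta> \<le> \<eta> * N" for N \<Delta>
  proof -
    have 1: "3 * real J ^ 2 * 2 ^ J \<le> N" using N2 N by linarith
    have "4 * real J ^ 3 * \<Delta> \<le> 4 * real J ^ 3 * (\<eta> * N)" using few by (intro mult_left_mono) auto
    also have "\<dots> \<le> (4 * real J ^ 3 + 1) * (\<eta> * N)" using eta by (intro mult_right_mono) auto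
    also have "\<dots> = d * N" by (simp add: \<eta>_def add_nonneg_eq_0_iff)
    finally have 2: "4 * real J ^ 3 * \<Delta> \<le> N / 2 ^ (J + 1)" by (simp add: d_def)
    have 3: "6 * real J + 320 * real J * 4 ^ J / g \<le> c" by (simp add: c_def)
    have "2 * (3 * real N) ^ J * exp (lam\<^sup>2 * c\<^sup>2 * N) \<le> exp (lam * d / 2 * N) * exp (lam * d / 2 * N)"
      unfolding lam2 using N1[of N] N by (intro mult_right_mono) auto
    also have "\<dots> = exp (lam * d * N)" by (simp add: mult_exp_exp)
    finally have 4: "2 * (3 * real N) ^ J * exp (lam\<^sup>2 * c\<^sup>2 * N) \<le> exp (lam * (N / 2 ^ (J + 1)))"
      by (simp add: d_def)
    show ?thesis unfolding stage_ready_def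
      by (intro conjI 1 2, rule exI[of _ lam], rule exI[of _ c], intro conjI lam lamc 3 4)
  qed
  then show ?thesis using eta by blast
qed

lemma stages_ready_eventually:
  assumes g: "0 < g"
  shows "\<exists>\<eta>>0. \<exists>N1. \<forall>N\<ge>N1. \<forall>\<Delta>. real \<Delta> \<le> \<eta> * N \<longrightarrow> (\<forall>r\<le>R. stage_ready g (4 ^ r * J) N \<Delta>)"
proof (induction R)
  case 0
  then show ?case using stage_ready_eventually[OF g, of J] by simp
next
  case (Suc R)
  then obtain e1 N1 where 1: "e1 > 0" "\<And>N \<Delta>. N \<ge> N1 \<Longrightarrow> real \<Delta> \<le> e1 * N \<Longrightarrow> \<forall>r\<le>R. stage_ready g (4 ^ r * J) N \<Delta>"
    by blast
  obtain e2 N2 where 2: "e2 > 0" "\<And>N \<Delta>. N \<ge> N2 \<Longrightarrow> real \<Delta> \<le> e2 * N \<Longrightarrow> stage_ready g (4 ^ Suc R * J) N \<Delta>"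
    using stage_ready_eventually[OF g, of "4 ^ Suc R * J"] by blast
  show ?case
  proof (intro exI[of _ "min e1 e2"] exI[of _ "max N1 N2"] conjI allI impI)
    show "min e1 e2 > 0" using 1 2 by simp
    fix N \<Delta> r assume N: "max N1 N2 \<le> N" and few: "real \<Delta> \<le> min e1 e2 * real N" and r: "r \<le> Suc R"
    have "real \<Delta> \<le> e1 * N" "real \<Delta> \<le> e2 * N"
      using few mult_right_mono[of "min e1 e2" e1 "real N"] mult_right_mono[of "min e1 e2" e2 "real N"] by auto
    then show "stage_ready g (4 ^ r * J) N \<Delta>" using 1(2) 2(2) N r by (auto simp: le_Suc_eq)
  qed
qed

context labelling_game begin

text \<open>The rounded-down stage length is at least g * N / 320, and each stage divides the pattern size by
  four; so R stages have to start from size \<open>4 ^ R * J0\<close>.\<close>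
lemma run_stages:
  assumes J0: "64 \<le> g * 2 ^ J0" and ready: "\<And>r. r \<le> R \<Longrightarrow> stage_ready g (4 ^ r * J0) N \<Delta>"
    and big: "320 \<le> g * N"
    and xs0: "valid xs0" "length xs0 \<le> n" "real (n - length xs0) \<le> R * (g * N / 320)" "quasirandom (4 ^ R * J0) xs0"
  shows "\<exists>xs. valid xs \<and> length xs = n"
  using ready xs0
proof (induction R arbitrary: xs0)
  case 0
  then show ?case by auto
next
  case (Suc R)
  define J where "J = 4 ^ Suc R * J0"
  define T where "T = nat \<lfloor>g * N / 160\<rfloor>"
  define m where "m = min n (length xs0 + T)"
  have gN: "0 \<le> g * N" using g by simp
  have T1: "real T \<le> g * N / 160" and T2: "g * N / 320 \<le> T"
    unfolding T_def using big by linarith+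
  have "J0 \<le> J" by (simp add: J_def)
  then have "(2::real) ^ J0 \<le> 2 ^ J" by (intro power_increasing) auto
  then have "g * 2 ^ J0 \<le> g * 2 ^ J" using g by (intro mult_left_mono) auto
  then have J64: "64 \<le> g * 2 ^ J" using J0 by linarith
  have "stage_ready g J N \<Delta>" using Suc.prems(1)[of "Suc R"] by (simp add: J_def)
  then obtain lam c :: real where c: "3 * real J ^ 2 * 2 ^ J \<le> N" "4 * real J ^ 3 * \<Delta> \<le> N / 2 ^ (J + 1)"
    "0 < lam" "lam * c \<le> 1" "6 * real J + 320 * real J * 4 ^ J / g \<le> c"
    "2 * (3 * real N) ^ J * exp (lam\<^sup>2 * c\<^sup>2 * N) \<le> exp (lam * (N / 2 ^ (J + 1)))"
    unfolding stage_ready_def by blast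
  have QJ: "quasirandom J xs0" using Suc.prems(5) by (simp add: J_def)
  have "m - length xs0 \<le> T" by (simp add: m_def)
  then have m: "length xs0 \<le> m" "m \<le> n" "real (m - length xs0) \<le> g * N / 160"
    using Suc.prems(3) T1 by (simp add: m_def, simp add: m_def, linarith)
  obtain ys where ys: "valid ys" "length ys = m" "quasirandom (J div 4) ys"
    using stage[OF Suc.prems(2) QJ m J64 c] by (elim exE conjE)
  have "quasirandom (4 ^ R * J0) ys" using ys(3) by (simp add: J_def)
  moreover have "real (n - length ys) \<le> R * (g * N / 320)"
  proof (cases "n \<le> length xs0 + T")
    case True
    then have "n - length ys = 0" using ys by (simp add: m_def)
    then show ?thesis using gN by simp
  next
    case False
    then have "real (n - length ys) = real (n - length xs0) - T" using ys by (simp add: m_def of_nat_diff)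
    also have "\<dots> \<le> real (Suc R) * (g * N / 320) - g * N / 320" using Suc.prems(4) T2 by linarith
    also have "\<dots> = R * (g * N / 320)" by (simp add: algebra_simps add_divide_distrib)
    finally show ?thesis .
  qed
  ultimately show ?case using Suc.IH[of ys] Suc.prems(1) ys m by auto
qed

lemma full_labelling:
  assumes J0: "64 \<le> g * 2 ^ J0" and ready: "\<And>r. r \<le> R \<Longrightarrow> stage_ready g (4 ^ r * J0) N \<Delta>"
    and big: "320 \<le> g * N" and R: "160 / g \<le> R" and n: "1 \<le> n"
  shows "\<exists>xs. valid xs \<and> length xs = n"
proof (rule run_stages[OF J0 ready big valid_start])
  show "length [0::int] \<le> n" using n by simp
  \<comment> \<open>The number of stages is chosen so that their total length is at least N / 2, hence more than n.\<close>
  have half: "160 / g * (g * N / 320) = real N / 2" using g by simp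
  have "real (n - length [0::int]) \<le> real N / 2" using n_lt_N by simp
  also have "\<dots> \<le> R * (g * N / 320)"
    unfolding half[symmetric] using R g by (intro mult_right_mono) auto
  finally show "real (n - length [0::int]) \<le> R * (g * N / 320)" .
  define J where "J = 4 ^ R * J0"
  have "stage_ready g J N \<Delta>" using ready[of R] by (simp add: J_def)
  then have N: "3 * real J ^ 2 * 2 ^ J \<le> N" by (simp add: stage_ready_def)
  have "real J \<le> real J ^ 2" by (cases J) (auto simp: power2_eq_square)
  then have "2 * real J \<le> 3 * real J ^ 2" using zero_le_power2[of "real J"] by linarith
  then have "2 * real J * 2 ^ J \<le> 3 * real J ^ 2 * 2 ^ J" by (intro mult_right_mono) auto
  then have "2 * real J * 2 ^ J \<le> N" using N by (rule order_trans)
  then have "quasirandom J [0]" by (rule quasirandom_initial)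
  then show "quasirandom (4 ^ R * J0) [0]" by (simp only: J_def)
qed

end

section \<open>Almost every difference can be used\<close>
theorem mainTheorem3:
  fixes \<gamma> :: real
  assumes "\<gamma> > 0"
  shows "\<exists>\<eta>::real. \<eta> > 0 \<and> (\<exists>n\<^sub>0::nat. \<forall>n>n\<^sub>0. \<forall>(T :: 'a ugraph) (N :: nat).
           tree T \<longrightarrow> card (verts T) = n \<longrightarrow>
           real (max_degree T) \<le> \<eta> * real n / ln (real n) \<longrightarrow>
           int N = \<lceil>(2 + 2 * \<gamma>) * real n\<rceil> - 1 \<longrightarrow>
           packs_cyclically T N)"
proof -
  \<comment> \<open>At least N - 2 * n, about 2 * \<gamma> * n, differences are never used; this is a proportion of at least 2 * g.\<close>
  define g where "g = \<gamma> / (4 + 4 * \<gamma>)"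
  have g: "0 < g" "g \<le> 1" using assms by (auto simp: g_def field_simps)
  obtain J0 where "64 / g < 2 ^ J0" using real_arch_pow[of 2 "64 / g"] by auto
  then have J0: "64 \<le> g * 2 ^ J0" using g by (simp add: field_simps)
  define R where "R = nat \<lceil>160 / g\<rceil>"
  have R: "160 / g \<le> R" unfolding R_def by linarith
  obtain \<eta> N1 where eta: "\<eta> > 0"
    and ready: "\<And>N \<Delta>. N \<ge> N1 \<Longrightarrow> real \<Delta> \<le> \<eta> * N \<Longrightarrow> \<forall>r\<le>R. stage_ready g (4 ^ r * J0) N \<Delta>"
    using stages_ready_eventually[OF g(1), of R J0] by blast
  obtain n1 :: nat where n1: "1 / \<gamma> \<le> n1" using real_arch_simple by blast
  obtain n2 :: nat where n2: "320 / g \<le> n2" using real_arch_simple by blast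
  have "packs_cyclically T N"
    if n: "n > max 3 (max N1 (max n1 n2))" and T: "tree T" "card (verts T) = n"
      and deg: "real (max_degree T) \<le> \<eta> * real n / ln (real n)"
      and N: "int N = \<lceil>(2 + 2 * \<gamma>) * real n\<rceil> - 1" for n N and T :: "'a ugraph"
  proof -
    have "real N = real_of_int (\<lceil>(2 + 2 * \<gamma>) * real n\<rceil> - 1)" using N by (metis of_int_of_nat_eq)
    then have Nlo: "(2 + 2 * \<gamma>) * n - 1 \<le> N" and Nhi: "N \<le> (2 + 2 * \<gamma>) * n" by linarith+
    have "1 / \<gamma> \<le> n" using n n1 by linarith
    then have gn: "1 \<le> \<gamma> * n" using assms by (simp add: field_simps)
    have "2 * g * N \<le> 2 * g * ((2 + 2 * \<gamma>) * n)" using Nhi g by (intro mult_left_mono) auto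
    also have "\<dots> = \<gamma> * n" using assms by (simp add: g_def field_simps)
    finally have gN: "2 * g * N \<le> \<gamma> * n" .
    have room: "2 * g * N \<le> real N - 2 * real n" using gN Nlo gn by (simp add: algebra_simps)
    have nN: "n \<le> N" using Nlo gn n by (simp add: algebra_simps)
    have "ln (real n) \<ge> 1"
    proof -
      have "exp 1 \<le> real n" using exp_le n by linarith
      then show ?thesis using ln_ge_iff[of "real n" 1] n by simp
    qed
    then have "\<eta> * real n / ln (real n) \<le> \<eta> * real n / 1" using eta n by (intro divide_left_mono) auto
    also have "\<dots> \<le> \<eta> * N" using eta nN by simp
    finally have few: "real (max_degree T) \<le> \<eta> * N" using deg by linarith
    obtain vs par where vs: "distinct vs" "set vs = verts T" "length vs = n"
      and vpar: "\<And>i. 1 \<le> i \<Longrightarrow> i < n \<Longrightarrow> par i < i \<and> {vs ! i, vs ! par i} \<in> edges T"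
      and vpar': "\<And>i j. j < i \<Longrightarrow> i < n \<Longrightarrow> {vs ! i, vs ! j} \<in> edges T \<Longrightarrow> j = par i"
      using tree_order[OF T] by blast
    interpret labelling_game N n par "max_degree T" g
    proof
      show "0 < N" using nN n by simp
      show "par i < i" if "1 \<le> i" "i < n" for i using vpar that by blast
      show "card {i \<in> {1..<n}. par i = k} \<le> max_degree T" for k
        using few_children[OF _ vs vpar] T by (simp add: tree_def)
    qed (use g room in auto)
    have "320 \<le> g * N"
    proof -
      have "320 / g \<le> N" using n2 n nN by linarith
      then show ?thesis using g by (simp add: field_simps)
    qed
    moreover have "stage_ready g (4 ^ r * J0) N (max_degree T)" if "r \<le> R" for r
      using ready[OF _ few] that n nN by simp
    moreover have "1 \<le> n" using n by simp
    ultimately obtain xs where xs: "valid xs" "length xs = n"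
      using full_labelling[OF J0 _ _ R] by blast
    note vf = valid_facts[OF xs(1)] and vr = valid_rainbow[OF xs(1), unfolded xs(2)]
    show ?thesis
    proof (rule packing_from_labels[OF T(1) vs vpar vpar' xs(2)])
      show "distinct xs" "set xs \<subseteq> {0..<int N}" using vf by auto
      show "\<not> int N dvd 2 * (xs ! i - xs ! par i)" if "1 \<le> i" "i < n" for i
      proof -
        have "(xs ! i - xs ! par i) mod int N \<in> start_diffs" using vr that by auto
        then have "(2 * ((xs ! i - xs ! par i) mod int N)) mod int N \<noteq> 0"
          unfolding start_diffs_def mem_Collect_eq by (rule conjunct2)
        then have "(2 * (xs ! i - xs ! par i)) mod int N \<noteq> 0" unfolding mod_mult_right_eq .
        then show ?thesis unfolding mod_eq_0_iff_dvd .
      qed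
      fix i j assume ij: "1 \<le> i" "i < j" "j < n"
      then have "(xs ! j - xs ! par j) mod int N \<noteq> (xs ! i - xs ! par i) mod int N"
        and "(xs ! j - xs ! par j) mod int N \<noteq> (xs ! par i - xs ! i) mod int N"
        using vr by (meson atLeastLessThan_iff order.strict_trans order.strict_implies_order le_less_trans)+
      then show "\<not> int N dvd (xs ! j - xs ! par j) - (xs ! i - xs ! par i)"
        and "\<not> int N dvd (xs ! j - xs ! par j) + (xs ! i - xs ! par i)"
        unfolding mod_eq_dvd_iff by (simp_all only: diff_diff_eq2 diff_add_eq add_diff_eq not_False_eq_True)
    qed
  qed
  then show ?thesis using eta by blast
qed

end
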